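(* Let $A$ and $B$ be semisimple MV-algebras and let $A\otimes B$ be their semisimple tensor product. Let $\cdot\colon[0,1]^A\times[0,1]^B\to[0,1]^{A\times B}$ be the map defined by $(f\cdot g)(a,b):=f(a)\cdot g(b)$ (product of real numbers) for each $(f,g)\in[0,1]^A\times[0,1]^B$. Then the spaces $\mathscr{W}(A\otimes B)\subseteq[0,1]^{A\otimes B}$ and $\cdot(\mathscr{W}(A)\times\mathscr{W}(B))\subseteq[0,1]^{A\times B}$ (the image of $\mathscr{W}(A)\times\mathscr{W}(B)$ under the map $\cdot$) are $\mathbb{Z}$-homeomorphic.
   Context: An MV-algebra is an abelian monoid $(A,\oplus,0)$ with a unary operation $\neg$ such that $\neg\neg x=x$, $x\oplus\neg 0=\neg 0$, and $x\oplus\neg(x\oplus\neg y)=y\oplus\neg(y\oplus\neg x)$. Derived operations: $1=\neg0$, $x\odot y=\neg(\neg x\oplus\neg y)$, $x\vee y=\neg(\neg x\oplus y)\oplus y$, $x\wedge y=\neg(\neg x\vee\neg y)$. The standard MV-algebra is $[0,1]$ with $x\oplus y=\min\{x+y,1\}$, $\neg x=1-x$. An MV-algebra is semisimple if it is a subdirect product of simple MV-algebras, equivalently if it belongs to $\mathbb{ISP}([0,1])$. $\mathscr{F}(I)$ is the free MV-algebra on the set $I$; for $p\in[0,1]^I$, $\bar p\colon\mathscr{F}(I)\to[0,1]$ is the unique homomorphism extending $p$. $\mathscr{W}(A)=\mathsf{Hom}(A,[0,1])$ is the set of MV-homomorphisms from $A$ to the standard MV-algebra, viewed as a (closed) subspace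 of the cube $[0,1]^A$ with product topology. For $P\subseteq[0,1]^I$ and $Q\subseteq[0,1]^J$, a map $\eta\colon P\to Q$ is definable (equivalently, a $\mathbb{Z}$-map) if there are $t_j\in\mathscr{F}(I)$ ($j\in J$) with $(\eta(p))(j)=\bar p(t_j)$ for all $p\in P$, $j\in J$. $P$ and $Q$ are $\mathbb{Z}$-homeomorphic if there is a bijection $P\to Q$ that is definable and has definable inverse. Semisimple tensor product: let $R\subseteq\mathscr{F}(A\times B)^2$ be the set of the following pairs, for all $a,a_1,a_2\in A$, $b,b_1,b_2\in B$ (elements $(a,b)$ being free generators, and $\mathbf 0,\mathbf 1$ the constants of $\mathscr{F}(A\times B)$): $((1,1),\mathbf1)$, $((a,0),\mathbf0)$, $((0,b),\mathbf0)$; $((a,b_1\vee b_2),(a,b_1)\vee(a,b_2))$; $((a_1\vee a_2,b),(a_1,b)\vee(a_2,b))$; $((a,b_1\wedge b_2),(a,b_1)\wedge(a,b_2))$; $((a_1\wedge a_2,b),(a_1,b)\wedge(a_2,b))$; $((a,b_1)\odot(a,b_2),\mathbf0)$ and $((a,b_1\oplus b_2),(a,b_1)\oplus(a,b_2))$ whenever $b_1\odot b_2=0$; $((a_1,b)\odot(a_2,b),\mathbf0)$ and $((a_1\oplus a_2,b),(a_1,b)\oplus(a_2,b))$ whenever $a_1\odot a_2=0$. The MV-tensor product of $A$ and $B$ is $\mathscr{F}(A\times B)/\theta(R)$, where $\theta(R)$ is the congruence generated by $R$, and the semisimple tensor product $A\otimes B$ is its quotient by its radical (the intersection of all its maximal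 congruences). *)

theory Defs
  imports Complex_Main "HOL-Algebra.Group"
begin

section \<open>MV-algebras\<close>

record 'a mv = "'a partial_object" +
  mv_plus :: "['a, 'a] \<Rightarrow> 'a"  (infixl "\<oplus>\<index>" 65)
  mv_zero :: 'a  ("\<zero>\<index>")
  mv_neg :: "'a \<Rightarrow> 'a"  ("\<sim>\<index> _" [81] 80)

definition mv_one :: "'a mv \<Rightarrow> 'a"
  where "mv_one A = \<sim>\<^bsub>A\<^esub> \<zero>\<^bsub>A\<^esub>"

definition odot :: "'a mv \<Rightarrow> 'a \<Rightarrow> 'a \<Rightarrow> 'a"  (infixl "\<odot>\<index>" 70)
  where "x \<odot>\<^bsub>A\<^esub> y = \<sim>\<^bsub>A\<^esub> (\<sim>\<^bsub>A\<^esub> x \<oplus>\<^bsub>A\<^esub> \<sim>\<^bsub>A\<^esub> y)"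

definition mv_sup :: "'a mv \<Rightarrow> 'a \<Rightarrow> 'a \<Rightarrow> 'a"  (infixl "\<curlyvee>\<index>" 65)
  where "x \<curlyvee>\<^bsub>A\<^esub> y = \<sim>\<^bsub>A\<^esub> (\<sim>\<^bsub>A\<^esub> x \<oplus>\<^bsub>A\<^esub> y) \<oplus>\<^bsub>A\<^esub> y"

definition mv_inf :: "'a mv \<Rightarrow> 'a \<Rightarrow> 'a \<Rightarrow> 'a"  (infixl "\<curlywedge>\<index>" 70)
  where "x \<curlywedge>\<^bsub>A\<^esub> y = \<sim>\<^bsub>A\<^esub> (\<sim>\<^bsub>A\<^esub> x \<curlyvee>\<^bsub>A\<^esub> \<sim>\<^bsub>A\<^esub> y)"

definition mv_algebra :: "'a mv \<Rightarrow> bool" where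
  "mv_algebra A \<longleftrightarrow>
     comm_monoid \<lparr>carrier = carrier A, monoid.mult = mv_plus A, one = mv_zero A\<rparr> \<and>
     (\<forall>x\<in>carrier A. \<sim>\<^bsub>A\<^esub> x \<in> carrier A) \<and>
     (\<forall>x\<in>carrier A. \<sim>\<^bsub>A\<^esub> (\<sim>\<^bsub>A\<^esub> x) = x) \<and>
     (\<forall>x\<in>carrier A. x \<oplus>\<^bsub>A\<^esub> \<sim>\<^bsub>A\<^esub> \<zero>\<^bsub>A\<^esub> = \<sim>\<^bsub>A\<^esub> \<zero>\<^bsub>A\<^esub>) \<and>
     (\<forall>x\<in>carrier A. \<forall>y\<in>carrier A.
        x \<oplus>\<^bsub>A\<^esub> \<sim>\<^bsub>A\<^esub> (x \<oplus>\<^bsub>A\<^esub> \<sim>\<^bsub>A\<^esub> y) = y \<oplus>\<^bsub>A\<^esub> \<sim>\<^bsub>A\<^esub> (y \<oplus>\<^bsub>A\<^esub> \<sim>\<^bsub>A\<^esub> x))"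

definition std_mv :: "real mv" where
  "std_mv = \<lparr>carrier = {0..1}, mv_plus = (\<lambda>x y. min (x + y) 1), mv_zero = 0, mv_neg = (\<lambda>x. 1 - x)\<rparr>"

lemma mv_algebraD:
  assumes "mv_algebra A"
  shows "\<zero>\<^bsub>A\<^esub> \<in> carrier A"
    and "x \<in> carrier A \<Longrightarrow> \<sim>\<^bsub>A\<^esub> x \<in> carrier A"
    and "x \<in> carrier A \<Longrightarrow> y \<in> carrier A \<Longrightarrow> x \<oplus>\<^bsub>A\<^esub> y \<in> carrier A"
    and "x \<in> carrier A \<Longrightarrow> y \<in> carrier A \<Longrightarrow> z \<in> carrier A \<Longrightarrow>
      (x \<oplus>\<^bsub>A\<^esub> y) \<oplus>\<^bsub>A\<^esub> z = x \<oplus>\<^bsub>A\<^esub> (y \<oplus>\<^bsub>A\<^esub> z)"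
    and "x \<in> carrier A \<Longrightarrow> y \<in> carrier A \<Longrightarrow> x \<oplus>\<^bsub>A\<^esub> y = y \<oplus>\<^bsub>A\<^esub> x"
    and "x \<in> carrier A \<Longrightarrow> \<zero>\<^bsub>A\<^esub> \<oplus>\<^bsub>A\<^esub> x = x"
proof -
  interpret comm_monoid "\<lparr>carrier = carrier A, monoid.mult = mv_plus A, one = mv_zero A\<rparr>"
    using assms by (simp add: mv_algebra_def)
  show "\<zero>\<^bsub>A\<^esub> \<in> carrier A" using one_closed by simp
  show "x \<in> carrier A \<Longrightarrow> \<sim>\<^bsub>A\<^esub> x \<in> carrier A" using assms by (simp add: mv_algebra_def)
  show "x \<in> carrier A \<Longrightarrow> y \<in> carrier A \<Longrightarrow> x \<oplus>\<^bsub>A\<^esub> y \<in> carrier A" using m_closed by simp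
  show "x \<in> carrier A \<Longrightarrow> y \<in> carrier A \<Longrightarrow> z \<in> carrier A \<Longrightarrow>
      (x \<oplus>\<^bsub>A\<^esub> y) \<oplus>\<^bsub>A\<^esub> z = x \<oplus>\<^bsub>A\<^esub> (y \<oplus>\<^bsub>A\<^esub> z)" using m_assoc by simp
  show "x \<in> carrier A \<Longrightarrow> y \<in> carrier A \<Longrightarrow> x \<oplus>\<^bsub>A\<^esub> y = y \<oplus>\<^bsub>A\<^esub> x" using m_comm by simp
  show "x \<in> carrier A \<Longrightarrow> \<zero>\<^bsub>A\<^esub> \<oplus>\<^bsub>A\<^esub> x = x" using l_one by simp
qed

lemma mv_algebraI:
  assumes "\<zero>\<^bsub>A\<^esub> \<in> carrier A"
    and "\<And>x. x \<in> carrier A \<Longrightarrow> \<sim>\<^bsub>A\<^esub> x \<in> carrier A"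
    and "\<And>x y. x \<in> carrier A \<Longrightarrow> y \<in> carrier A \<Longrightarrow> x \<oplus>\<^bsub>A\<^esub> y \<in> carrier A"
    and "\<And>x y z. x \<in> carrier A \<Longrightarrow> y \<in> carrier A \<Longrightarrow> z \<in> carrier A \<Longrightarrow>
      (x \<oplus>\<^bsub>A\<^esub> y) \<oplus>\<^bsub>A\<^esub> z = x \<oplus>\<^bsub>A\<^esub> (y \<oplus>\<^bsub>A\<^esub> z)"
    and "\<And>x y. x \<in> carrier A \<Longrightarrow> y \<in> carrier A \<Longrightarrow> x \<oplus>\<^bsub>A\<^esub> y = y \<oplus>\<^bsub>A\<^esub> x"
    and "\<And>x. x \<in> carrier A \<Longrightarrow> \<zero>\<^bsub>A\<^esub> \<oplus>\<^bsub>A\<^esub> x = x"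
    and "\<And>x. x \<in> carrier A \<Longrightarrow> \<sim>\<^bsub>A\<^esub> (\<sim>\<^bsub>A\<^esub> x) = x"
    and "\<And>x. x \<in> carrier A \<Longrightarrow> x \<oplus>\<^bsub>A\<^esub> \<sim>\<^bsub>A\<^esub> \<zero>\<^bsub>A\<^esub> = \<sim>\<^bsub>A\<^esub> \<zero>\<^bsub>A\<^esub>"
    and "\<And>x y. x \<in> carrier A \<Longrightarrow> y \<in> carrier A \<Longrightarrow>
        x \<oplus>\<^bsub>A\<^esub> \<sim>\<^bsub>A\<^esub> (x \<oplus>\<^bsub>A\<^esub> \<sim>\<^bsub>A\<^esub> y) = y \<oplus>\<^bsub>A\<^esub> \<sim>\<^bsub>A\<^esub> (y \<oplus>\<^bsub>A\<^esub> \<sim>\<^bsub>A\<^esub> x)"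
  shows "mv_algebra A"
  unfolding mv_algebra_def
  by (intro conjI ballI comm_monoidI) (use assms in auto)

lemma mv_algebra_std: "mv_algebra std_mv"
  by (rule mv_algebraI) (auto simp: std_mv_def min_def)

text \<open>Homomorphisms are extensional functions, so that \<open>mv_hom A B\<close> is literally a subset of
  the set-theoretic power of the carriers.\<close>

definition mv_hom :: "'a mv \<Rightarrow> 'b mv \<Rightarrow> ('a \<Rightarrow> 'b) set" where
  "mv_hom A B = {h \<in> carrier A \<rightarrow>\<^sub>E carrier B.
     h \<zero>\<^bsub>A\<^esub> = \<zero>\<^bsub>B\<^esub> \<and>
     (\<forall>x\<in>carrier A. h (\<sim>\<^bsub>A\<^esub> x) = \<sim>\<^bsub>B\<^esub> (h x)) \<and>
     (\<forall>x\<in>carrier A. \<forall>y\<in>carrier A. h (x \<oplus>\<^bsub>A\<^esub> y) = h x \<oplus>\<^bsub>B\<^esub> h y)}"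

section \<open>Congruences and quotients\<close>

text \<open>These are defined for any algebra of the signature, as they are applied to the algebra of
  terms as well.\<close>

definition congruence :: "'a mv \<Rightarrow> 'a rel \<Rightarrow> bool" where
  "congruence A \<theta> \<longleftrightarrow> \<theta> \<subseteq> carrier A \<times> carrier A \<and> equiv (carrier A) \<theta> \<and>
     (\<forall>(x, x') \<in> \<theta>. (\<sim>\<^bsub>A\<^esub> x, \<sim>\<^bsub>A\<^esub> x') \<in> \<theta>) \<and>
     (\<forall>(x, x') \<in> \<theta>. \<forall>(y, y') \<in> \<theta>. (x \<oplus>\<^bsub>A\<^esub> y, x' \<oplus>\<^bsub>A\<^esub> y') \<in> \<theta>)"

definition cong_gen :: "'a mv \<Rightarrow> 'a rel \<Rightarrow> 'a rel" where
  "cong_gen A R = \<Inter>{\<theta>. congruence A \<theta> \<and> R \<subseteq> \<theta>}"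

definition quot_mv :: "'a mv \<Rightarrow> 'a rel \<Rightarrow> 'a set mv" where
  "quot_mv A \<theta> =
     \<lparr>carrier = carrier A // \<theta>,
      mv_plus = (\<lambda>X Y. \<Union>x\<in>X. \<Union>y\<in>Y. \<theta> `` {x \<oplus>\<^bsub>A\<^esub> y}),
      mv_zero = \<theta> `` {\<zero>\<^bsub>A\<^esub>},
      mv_neg = (\<lambda>X. \<Union>x\<in>X. \<theta> `` {\<sim>\<^bsub>A\<^esub> x})\<rparr>"

lemma congruenceD:
  assumes "congruence A \<theta>"
  shows "equiv (carrier A) \<theta>"
    and "(x, x') \<in> \<theta> \<Longrightarrow> x \<in> carrier A" and "(x, x') \<in> \<theta> \<Longrightarrow> x' \<in> carrier A"
    and "(x, x') \<in> \<theta> \<Longrightarrow> (\<sim>\<^bsub>A\<^esub> x, \<sim>\<^bsub>A\<^esub> x') \<in> \<theta>"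
    and "(x, x') \<in> \<theta> \<Longrightarrow> (y, y') \<in> \<theta> \<Longrightarrow> (x \<oplus>\<^bsub>A\<^esub> y, x' \<oplus>\<^bsub>A\<^esub> y') \<in> \<theta>"
  using assms unfolding congruence_def by blast+

lemma quot_mv_ops:
  assumes "congruence A \<theta>"
  shows "carrier (quot_mv A \<theta>) = (\<lambda>x. \<theta> `` {x}) ` carrier A"
    and "\<zero>\<^bsub>quot_mv A \<theta>\<^esub> = \<theta> `` {\<zero>\<^bsub>A\<^esub>}"
    and "x \<in> carrier A \<Longrightarrow> \<sim>\<^bsub>quot_mv A \<theta>\<^esub> (\<theta> `` {x}) = \<theta> `` {\<sim>\<^bsub>A\<^esub> x}"
    and "x \<in> carrier A \<Longrightarrow> y \<in> carrier A \<Longrightarrow>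
      \<theta> `` {x} \<oplus>\<^bsub>quot_mv A \<theta>\<^esub> \<theta> `` {y} = \<theta> `` {x \<oplus>\<^bsub>A\<^esub> y}"
proof -
  note c = congruenceD[OF assms]
  show "carrier (quot_mv A \<theta>) = (\<lambda>x. \<theta> `` {x}) ` carrier A"
    by (auto simp: quot_mv_def quotient_def)
  show "\<zero>\<^bsub>quot_mv A \<theta>\<^esub> = \<theta> `` {\<zero>\<^bsub>A\<^esub>}" by (simp add: quot_mv_def)
  have *: "congruent \<theta> (\<lambda>x. \<theta> `` {\<sim>\<^bsub>A\<^esub> x})"
    by (rule congruentI) (meson c(1,4) equiv_class_eq)
  show "x \<in> carrier A \<Longrightarrow> \<sim>\<^bsub>quot_mv A \<theta>\<^esub> (\<theta> `` {x}) = \<theta> `` {\<sim>\<^bsub>A\<^esub> x}"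
    using UN_equiv_class[OF c(1) *] by (simp add: quot_mv_def)
  have *: "congruent2 \<theta> \<theta> (\<lambda>x y. \<theta> `` {x \<oplus>\<^bsub>A\<^esub> y})"
    by (rule congruent2I') (meson c(1,5) equiv_class_eq)
  show "x \<in> carrier A \<Longrightarrow> y \<in> carrier A \<Longrightarrow>
      \<theta> `` {x} \<oplus>\<^bsub>quot_mv A \<theta>\<^esub> \<theta> `` {y} = \<theta> `` {x \<oplus>\<^bsub>A\<^esub> y}"
    using UN_equiv_class2[OF c(1) c(1) *] by (simp add: quot_mv_def)
qed

lemma mv_algebra_quot:
  assumes "mv_algebra A" "congruence A \<theta>"
  shows "mv_algebra (quot_mv A \<theta>)"
proof -
  have ax: "x \<in> carrier A \<Longrightarrow> \<sim>\<^bsub>A\<^esub> (\<sim>\<^bsub>A\<^esub> x) = x"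
    "x \<in> carrier A \<Longrightarrow> x \<oplus>\<^bsub>A\<^esub> \<sim>\<^bsub>A\<^esub> \<zero>\<^bsub>A\<^esub> = \<sim>\<^bsub>A\<^esub> \<zero>\<^bsub>A\<^esub>"
    "x \<in> carrier A \<Longrightarrow> y \<in> carrier A \<Longrightarrow>
      x \<oplus>\<^bsub>A\<^esub> \<sim>\<^bsub>A\<^esub> (x \<oplus>\<^bsub>A\<^esub> \<sim>\<^bsub>A\<^esub> y) = y \<oplus>\<^bsub>A\<^esub> \<sim>\<^bsub>A\<^esub> (y \<oplus>\<^bsub>A\<^esub> \<sim>\<^bsub>A\<^esub> x)" for x y
    using assms(1) unfolding mv_algebra_def by blast+
  note d = mv_algebraD[OF assms(1)]
  note q = quot_mv_ops(2-4)[OF assms(2)]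
  show ?thesis
  proof (rule mv_algebraI, unfold quot_mv_ops(1)[OF assms(2)])
    fix X Y assume "X \<in> (\<lambda>x. \<theta> `` {x}) ` carrier A" "Y \<in> (\<lambda>x. \<theta> `` {x}) ` carrier A"
    then obtain x y where *: "X = \<theta> `` {x}" "x \<in> carrier A" "Y = \<theta> `` {y}" "y \<in> carrier A"
      by blast
    then show "X \<oplus>\<^bsub>quot_mv A \<theta>\<^esub> Y = Y \<oplus>\<^bsub>quot_mv A \<theta>\<^esub> X"
      using d(5)[OF *(2,4)] by (simp add: q)
    show "X \<oplus>\<^bsub>quot_mv A \<theta>\<^esub> \<sim>\<^bsub>quot_mv A \<theta>\<^esub> (X \<oplus>\<^bsub>quot_mv A \<theta>\<^esub> \<sim>\<^bsub>quot_mv A \<theta>\<^esub> Y) =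
        Y \<oplus>\<^bsub>quot_mv A \<theta>\<^esub> \<sim>\<^bsub>quot_mv A \<theta>\<^esub> (Y \<oplus>\<^bsub>quot_mv A \<theta>\<^esub> \<sim>\<^bsub>quot_mv A \<theta>\<^esub> X)"
      using ax(3)[OF *(2,4)] * by (simp add: q d(1-3))
  qed (auto simp: q d(1-4,6) ax(1,2))
qed

lemma congruence_total:
  assumes "\<And>x. x \<in> carrier A \<Longrightarrow> \<sim>\<^bsub>A\<^esub> x \<in> carrier A"
    and "\<And>x y. x \<in> carrier A \<Longrightarrow> y \<in> carrier A \<Longrightarrow> x \<oplus>\<^bsub>A\<^esub> y \<in> carrier A"
  shows "congruence A (carrier A \<times> carrier A)"
  unfolding congruence_def
  by (auto simp: assms equiv_def refl_on_def sym_def trans_def)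

lemma congruence_cong_gen:
  assumes "\<And>x. x \<in> carrier A \<Longrightarrow> \<sim>\<^bsub>A\<^esub> x \<in> carrier A"
    and "\<And>x y. x \<in> carrier A \<Longrightarrow> y \<in> carrier A \<Longrightarrow> x \<oplus>\<^bsub>A\<^esub> y \<in> carrier A"
    and "R \<subseteq> carrier A \<times> carrier A"
  shows "congruence A (cong_gen A R)"
proof -
  have total: "congruence A (carrier A \<times> carrier A)"
    by (rule congruence_total[OF assms(1,2)])
  have mem: "(x, y) \<in> cong_gen A R \<longleftrightarrow> (\<forall>\<theta>. congruence A \<theta> \<and> R \<subseteq> \<theta> \<longrightarrow> (x, y) \<in> \<theta>)" for x y
    by (simp add: cong_gen_def)
  have sub: "cong_gen A R \<subseteq> carrier A \<times> carrier A"
    using total assms(3) by (auto simp: cong_gen_def)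
  moreover have "equiv (carrier A) (cong_gen A R)"
  proof (rule equivI)
    show "cong_gen A R \<subseteq> carrier A \<times> carrier A" by (rule sub)
    show "refl_on (carrier A) (cong_gen A R)"
      by (rule refl_onI) (use congruenceD(1) in \<open>fastforce simp: mem equiv_def refl_on_def\<close>)
    show "sym (cong_gen A R)"
      by (rule symI) (meson mem congruenceD(1) equiv_def symD)
    show "trans (cong_gen A R)"
      by (rule transI) (meson mem congruenceD(1) equiv_def transD)
  qed
  moreover have "(\<sim>\<^bsub>A\<^esub> x, \<sim>\<^bsub>A\<^esub> x') \<in> cong_gen A R" if "(x, x') \<in> cong_gen A R" for x x'
    using that congruenceD(4) unfolding mem by metis
  moreover have "(x \<oplus>\<^bsub>A\<^esub> y, x' \<oplus>\<^bsub>A\<^esub> y') \<in> cong_gen A R"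
    if "(x, x') \<in> cong_gen A R" "(y, y') \<in> cong_gen A R" for x x' y y'
    using that congruenceD(5) unfolding mem by metis
  ultimately show ?thesis
    unfolding congruence_def by blast
qed

lemma cong_gen_least: "congruence A \<theta> \<Longrightarrow> R \<subseteq> \<theta> \<Longrightarrow> cong_gen A R \<subseteq> \<theta>"
  unfolding cong_gen_def by blast

lemma cong_gen_incl: "R \<subseteq> cong_gen A R"
  unfolding cong_gen_def by blast

definition maximal_congruence :: "'a mv \<Rightarrow> 'a rel \<Rightarrow> bool" where
  "maximal_congruence A \<theta> \<longleftrightarrow> congruence A \<theta> \<and> \<theta> \<noteq> carrier A \<times> carrier A \<and>
     (\<forall>\<phi>. congruence A \<phi> \<and> \<theta> \<subseteq> \<phi> \<longrightarrow> \<phi> = \<theta> \<or> \<phi> = carrier A \<times> carrier A)"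

text \<open>The intersection is taken inside \<open>carrier A \<times> carrier A\<close>: the radical of the trivial algebra,
  which has no maximal congruence, is the total congruence.\<close>

definition radical :: "'a mv \<Rightarrow> 'a rel" where
  "radical A = {(x, y) \<in> carrier A \<times> carrier A. \<forall>\<theta>. maximal_congruence A \<theta> \<longrightarrow> (x, y) \<in> \<theta>}"

section \<open>Semisimple MV-algebras\<close>

definition simple_mv :: "'a mv \<Rightarrow> bool" where
  "simple_mv A \<longleftrightarrow> Id_on (carrier A) \<noteq> carrier A \<times> carrier A \<and>
     {\<theta>. congruence A \<theta>} = {Id_on (carrier A), carrier A \<times> carrier A}"

definition prod_mv :: "'k set \<Rightarrow> ('k \<Rightarrow> 'a mv) \<Rightarrow> ('k \<Rightarrow> 'a) mv" where
  "prod_mv K S =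
     \<lparr>carrier = (\<Pi>\<^sub>E k\<in>K. carrier (S k)),
      mv_plus = (\<lambda>x y. \<lambda>k\<in>K. x k \<oplus>\<^bsub>S k\<^esub> y k),
      mv_zero = (\<lambda>k\<in>K. \<zero>\<^bsub>S k\<^esub>),
      mv_neg = (\<lambda>x. \<lambda>k\<in>K. \<sim>\<^bsub>S k\<^esub> (x k))\<rparr>"

definition subdirect_embedding ::
  "'a mv \<Rightarrow> 'k set \<Rightarrow> ('k \<Rightarrow> 'b mv) \<Rightarrow> ('a \<Rightarrow> 'k \<Rightarrow> 'b) \<Rightarrow> bool" where
  "subdirect_embedding A K S h \<longleftrightarrow> h \<in> mv_hom A (prod_mv K S) \<and> inj_on h (carrier A) \<and>
     (\<forall>k\<in>K. (\<lambda>x. h x k) ` carrier A = carrier (S k))"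

text \<open>The types of the index set and of the factors cannot be quantified, and are fixed to types
  large enough to index the congruences of \<open>A\<close> and to hold its quotients. This is no restriction:
  see \<open>semisimple_mvI\<close> below.\<close>

definition semisimple_mv :: "'a mv \<Rightarrow> bool" where
  "semisimple_mv A \<longleftrightarrow> (\<exists>(K :: 'a rel set) (S :: 'a rel \<Rightarrow> 'a set mv) h.
     (\<forall>k\<in>K. mv_algebra (S k) \<and> simple_mv (S k)) \<and> subdirect_embedding A K S h)"

lemma simple_mv_iso:
  assumes g: "bij_betw g (carrier B) (carrier A)"
    and neg: "\<And>x. x \<in> carrier B \<Longrightarrow> \<sim>\<^bsub>B\<^esub> x \<in> carrier B \<and> g (\<sim>\<^bsub>B\<^esub> x) = \<sim>\<^bsub>A\<^esub> (g x)"
    and plus: "\<And>x y. x \<in> carrier B \<Longrightarrow> y \<in> carrier B \<Longrightarrow>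
      x \<oplus>\<^bsub>B\<^esub> y \<in> carrier B \<and> g (x \<oplus>\<^bsub>B\<^esub> y) = g x \<oplus>\<^bsub>A\<^esub> g y"
    and simple: "simple_mv A"
  shows "simple_mv B"
proof -
  have inj: "g x = g y \<longleftrightarrow> x = y" if "x \<in> carrier B" "y \<in> carrier B" for x y
    using g that by (auto simp: bij_betw_def inj_on_def)
  have surj: "carrier A = g ` carrier B" using g by (simp add: bij_betw_def)
  obtain u v where uv: "u \<in> carrier A" "v \<in> carrier A" "u \<noteq> v"
    using simple unfolding simple_mv_def by auto
  then obtain x y where "x \<in> carrier B" "u = g x" "y \<in> carrier B" "v = g y"
    unfolding surj by (elim imageE)
  with uv(3) have xy: "x \<in> carrier B" "y \<in> carrier B" "x \<noteq> y" by auto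
  then have "(x, y) \<in> carrier B \<times> carrier B" "(x, y) \<notin> Id_on (carrier B)" by auto
  then have nontrivial: "Id_on (carrier B) \<noteq> carrier B \<times> carrier B" by blast
  have "congruence B (Id_on (carrier B))"
    using neg plus by (auto simp: congruence_def equiv_def refl_on_def sym_def trans_def)
  moreover have "congruence B (carrier B \<times> carrier B)"
    using neg plus by (intro congruence_total) auto
  moreover have "\<phi> = Id_on (carrier B) \<or> \<phi> = carrier B \<times> carrier B" if \<phi>: "congruence B \<phi>" for \<phi>
  proof -
    note c = congruenceD[OF \<phi>]
    have refl: "(x, x) \<in> \<phi>" if "x \<in> carrier B" for x
      using c(1) that by (auto simp: equiv_def refl_on_def)
    have sym: "(y, x) \<in> \<phi>" if "(x, y) \<in> \<phi>" for x y
      using c(1) that by (auto simp: equiv_def sym_def)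
    have trans: "(x, z) \<in> \<phi>" if "(x, y) \<in> \<phi>" "(y, z) \<in> \<phi>" for x y z
      using c(1) that unfolding equiv_def trans_def by blast
    define \<psi> where "\<psi> = {(g x, g y) | x y. (x, y) \<in> \<phi>}"
    have mem: "(g x, g y) \<in> \<psi> \<longleftrightarrow> (x, y) \<in> \<phi>" if "x \<in> carrier B" "y \<in> carrier B" for x y
      unfolding \<psi>_def using inj that c(2,3) by blast
    let ?\<psi> = "{(g x, g y) | x y. (x, y) \<in> \<phi>}"
    have "congruence A \<psi>"
      unfolding congruence_def \<psi>_def
    proof (intro conjI)
      show sub: "?\<psi> \<subseteq> carrier A \<times> carrier A" unfolding surj using c(2,3) by auto
      show "equiv (carrier A) ?\<psi>"
      proof (rule equivI)
        show "?\<psi> \<subseteq> carrier A \<times> carrier A" by (rule sub)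
        show "refl_on (carrier A) ?\<psi>" unfolding surj using refl by (auto intro!: refl_onI)
        show "sym ?\<psi>" using sym by (auto intro!: symI)
        show "trans ?\<psi>"
        proof (rule transI)
          fix u v w assume "(u, v) \<in> ?\<psi>" "(v, w) \<in> ?\<psi>"
          then obtain x y y' z where *: "u = g x" "v = g y" "v = g y'" "w = g z"
            "(x, y) \<in> \<phi>" "(y', z) \<in> \<phi>" by blast
          then have "y = y'" using inj c(2,3) by metis
          with * trans show "(u, w) \<in> ?\<psi>" by blast
        qed
      qed
      show "\<forall>(u, u') \<in> ?\<psi>. (\<sim>\<^bsub>A\<^esub> u, \<sim>\<^bsub>A\<^esub> u') \<in> ?\<psi>"
      proof clarify
        fix x x' assume "(x, x') \<in> \<phi>"
        then show "\<exists>y y'. (\<sim>\<^bsub>A\<^esub> g x, \<sim>\<^bsub>A\<^esub> g x') = (g y, g y') \<and> (y, y') \<in> \<phi>"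
          using c(4) neg c(2,3) by (intro exI[of _ "\<sim>\<^bsub>B\<^esub> x"] exI[of _ "\<sim>\<^bsub>B\<^esub> x'"]) auto
      qed
      show "\<forall>(u, u') \<in> ?\<psi>. \<forall>(v, v') \<in> ?\<psi>. (u \<oplus>\<^bsub>A\<^esub> v, u' \<oplus>\<^bsub>A\<^esub> v') \<in> ?\<psi>"
      proof clarify
        fix x x' y y' assume *: "(x, x') \<in> \<phi>" "(y, y') \<in> \<phi>"
        then show "\<exists>z z'. (g x \<oplus>\<^bsub>A\<^esub> g y, g x' \<oplus>\<^bsub>A\<^esub> g y') = (g z, g z') \<and> (z, z') \<in> \<phi>"
          using c(5)[OF *] plus c(2,3)
          by (intro exI[of _ "x \<oplus>\<^bsub>B\<^esub> y"] exI[of _ "x' \<oplus>\<^bsub>B\<^esub> y'"]) auto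
      qed
    qed
    moreover have "{\<theta>. congruence A \<theta>} = {Id_on (carrier A), carrier A \<times> carrier A}"
      using simple unfolding simple_mv_def by (rule conjunct2)
    ultimately have "\<psi> \<in> {Id_on (carrier A), carrier A \<times> carrier A}"
      by (metis CollectI)
    then have "\<psi> = Id_on (carrier A) \<or> \<psi> = carrier A \<times> carrier A"
      by simp
    then show ?thesis
    proof
      assume *: "\<psi> = Id_on (carrier A)"
      have "x = y" if "(x, y) \<in> \<phi>" for x y
      proof -
        have "(g x, g y) \<in> \<psi>" using that mem c(2,3) by blast
        then have "g x = g y" unfolding * by (simp add: Id_on_iff)
        then show ?thesis using inj[OF c(2,3)[OF that]] by simp
      qed
      then have "(x, y) \<in> \<phi> \<longleftrightarrow> (x, y) \<in> Id_on (carrier B)" for x y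
        unfolding Id_on_iff using refl c(2) by blast
      then show ?thesis by (intro disjI1 subset_antisym subrelI) simp_all
    next
      assume *: "\<psi> = carrier A \<times> carrier A"
      have "(x, y) \<in> \<phi>" if xy: "x \<in> carrier B" "y \<in> carrier B" for x y
      proof -
        have "(g x, g y) \<in> carrier A \<times> carrier A" unfolding surj using xy by simp
        then show ?thesis using mem[OF xy] unfolding * by simp
      qed
      then have "(x, y) \<in> \<phi> \<longleftrightarrow> (x, y) \<in> carrier B \<times> carrier B" for x y
        unfolding mem_Times_iff fst_conv snd_conv using c(2,3) by blast
      then show ?thesis by (intro disjI2 subset_antisym subrelI) simp_all
    qed
  qed
  ultimately have iff: "congruence B \<phi> \<longleftrightarrow> \<phi> = Id_on (carrier B) \<or> \<phi> = carrier B \<times> carrier B" for \<phi>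
    by metis
  have "{\<phi>. congruence B \<phi>} = {Id_on (carrier B), carrier B \<times> carrier B}"
    by (rule Set.set_eqI) (simp only: mem_Collect_eq iff insert_iff empty_iff simp_thms)
  with nontrivial show ?thesis unfolding simple_mv_def by simp
qed

lemma semisimple_mvI:
  fixes A :: "'a mv" and K :: "'k set" and S :: "'k \<Rightarrow> 'b mv"
  assumes A: "mv_algebra A"
    and S: "\<And>k. k \<in> K \<Longrightarrow> mv_algebra (S k) \<and> simple_mv (S k)"
    and h: "subdirect_embedding A K S h"
  shows "semisimple_mv A"
proof -
  note d = mv_algebraD[OF A]
  define \<theta> where "\<theta> k = {(x, y) \<in> carrier A \<times> carrier A. h x k = h y k}" for k
  have hom: "h (\<sim>\<^bsub>A\<^esub> x) k = \<sim>\<^bsub>S k\<^esub> (h x k)" "h (x \<oplus>\<^bsub>A\<^esub> y) k = h x k \<oplus>\<^bsub>S k\<^esub> h y k"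
    if "k \<in> K" "x \<in> carrier A" "y \<in> carrier A" for k x y
    using h that by (auto simp: subdirect_embedding_def mv_hom_def prod_mv_def)
  have cong: "congruence A (\<theta> k)" if "k \<in> K" for k
    using hom[OF that] d(1-3)
    by (auto simp: congruence_def \<theta>_def equiv_def refl_on_def sym_def trans_def)
  have congK: "congruence A \<phi>" if "\<phi> \<in> \<theta> ` K" for \<phi>
    using that cong by blast
  note q = quot_mv_ops[OF cong]
  have cl_eq: "\<theta> k `` {x} = \<theta> k `` {y} \<longleftrightarrow> h x k = h y k"
    if "k \<in> K" "x \<in> carrier A" "y \<in> carrier A" for k x y
    using eq_equiv_class_iff[OF congruenceD(1)[OF cong[OF that(1)]] that(2,3)] that
    by (simp add: \<theta>_def)
  have simple: "simple_mv (quot_mv A (\<theta> k))" if k: "k \<in> K" for k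
  proof -
    define g where "g X = h (SOME x. x \<in> X) k" for X
    have g: "g (\<theta> k `` {x}) = h x k" if x: "x \<in> carrier A" for x
    proof -
      have "x \<in> \<theta> k `` {x}" using x by (simp add: \<theta>_def)
      then have "(SOME y. y \<in> \<theta> k `` {x}) \<in> \<theta> k `` {x}" by (rule someI)
      then have "(x, SOME y. y \<in> \<theta> k `` {x}) \<in> \<theta> k" by simp
      then have "h x k = h (SOME y. y \<in> \<theta> k `` {x}) k" unfolding \<theta>_def by blast
      then show ?thesis by (simp add: g_def)
    qed
    show ?thesis
    proof (rule simple_mv_iso)
      show "simple_mv (S k)" using S k by blast
      show "bij_betw g (carrier (quot_mv A (\<theta> k))) (carrier (S k))"
        unfolding bij_betw_def
      proof
        show "inj_on g (carrier (quot_mv A (\<theta> k)))"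
        proof (rule inj_onI)
          fix X Y
          assume "X \<in> carrier (quot_mv A (\<theta> k))" "Y \<in> carrier (quot_mv A (\<theta> k))" and eq: "g X = g Y"
          then obtain x y where *: "X = \<theta> k `` {x}" "x \<in> carrier A" "Y = \<theta> k `` {y}" "y \<in> carrier A"
            unfolding q(1)[OF k] by blast
          show "X = Y"
            using eq unfolding *(1,3) g[OF *(2)] g[OF *(4)] cl_eq[OF k *(2,4)] .
        qed
        have "g ` carrier (quot_mv A (\<theta> k)) = (\<lambda>x. h x k) ` carrier A"
          unfolding q(1)[OF k] image_image using g by (rule image_cong[OF refl])
        then show "g ` carrier (quot_mv A (\<theta> k)) = carrier (S k)"
          using h k by (simp add: subdirect_embedding_def)
      qed
    qed (auto simp: q[OF k] g d hom[OF k])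
  qed
  let ?h = "\<lambda>x\<in>carrier A. \<lambda>\<phi>\<in>\<theta> ` K. \<phi> `` {x}"
  have "?h \<in> mv_hom A (prod_mv (\<theta> ` K) (quot_mv A))"
    unfolding mv_hom_def prod_mv_def mem_Collect_eq partial_object.simps mv.simps
  proof (intro conjI ballI)
    have "\<phi> `` {x} \<in> carrier (quot_mv A \<phi>)" if "\<phi> \<in> \<theta> ` K" "x \<in> carrier A" for \<phi> x
      using that(2) by (simp add: quot_mv_def quotientI)
    then show "?h \<in> carrier A \<rightarrow>\<^sub>E (\<Pi>\<^sub>E \<phi>\<in>\<theta> ` K. carrier (quot_mv A \<phi>))"
      by (intro PiE_I) simp_all
    show "?h \<zero>\<^bsub>A\<^esub> = (\<lambda>\<phi>\<in>\<theta> ` K. \<zero>\<^bsub>quot_mv A \<phi>\<^esub>)"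
      by (rule ext) (simp add: d(1) quot_mv_def)
    fix x assume x: "x \<in> carrier A"
    show "?h (\<sim>\<^bsub>A\<^esub> x) = (\<lambda>\<phi>\<in>\<theta> ` K. \<sim>\<^bsub>quot_mv A \<phi>\<^esub> (?h x \<phi>))"
    proof
      fix \<phi>
      have "\<phi> `` {\<sim>\<^bsub>A\<^esub> x} = \<sim>\<^bsub>quot_mv A \<phi>\<^esub> (\<phi> `` {x})" if "\<phi> \<in> \<theta> ` K"
        using quot_mv_ops(3)[OF congK[OF that] x] by simp
      then show "?h (\<sim>\<^bsub>A\<^esub> x) \<phi> = (\<lambda>\<phi>\<in>\<theta> ` K. \<sim>\<^bsub>quot_mv A \<phi>\<^esub> (?h x \<phi>)) \<phi>"
        using d(2)[OF x] x by (simp only: restrict_apply if_True split: if_split) blast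
    qed
    fix y assume y: "y \<in> carrier A"
    show "?h (x \<oplus>\<^bsub>A\<^esub> y) = (\<lambda>\<phi>\<in>\<theta> ` K. ?h x \<phi> \<oplus>\<^bsub>quot_mv A \<phi>\<^esub> ?h y \<phi>)"
    proof
      fix \<phi>
      have "\<phi> `` {x \<oplus>\<^bsub>A\<^esub> y} = \<phi> `` {x} \<oplus>\<^bsub>quot_mv A \<phi>\<^esub> \<phi> `` {y}" if "\<phi> \<in> \<theta> ` K"
        using quot_mv_ops(4)[OF congK[OF that] x y] by simp
      then show "?h (x \<oplus>\<^bsub>A\<^esub> y) \<phi> = (\<lambda>\<phi>\<in>\<theta> ` K. ?h x \<phi> \<oplus>\<^bsub>quot_mv A \<phi>\<^esub> ?h y \<phi>) \<phi>"
        using d(3)[OF x y] x y by (simp only: restrict_apply if_True split: if_split) blast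
    qed
  qed
  moreover have "inj_on ?h (carrier A)"
  proof (rule inj_onI)
    fix x y assume xy: "x \<in> carrier A" "y \<in> carrier A" and eq: "?h x = ?h y"
    have "h x k = h y k" if "k \<in> K" for k
      using fun_cong[OF eq, of "\<theta> k"] xy that cl_eq[OF that xy] by simp
    moreover have "h z \<in> extensional K" if "z \<in> carrier A" for z
    proof -
      have "h z \<in> carrier (prod_mv K S)"
        using h that unfolding subdirect_embedding_def mv_hom_def by blast
      then show ?thesis by (simp add: prod_mv_def PiE_def)
    qed
    ultimately have "h x = h y" using xy extensionalityI[of "h x" K "h y"] by simp
    then show "x = y" using h xy unfolding subdirect_embedding_def inj_on_def by blast
  qed
  ultimately have "subdirect_embedding A (\<theta> ` K) (quot_mv A) ?h"
    unfolding subdirect_embedding_def by (simp add: quot_mv_def quotient_def UNION_singleton_eq_range)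
  moreover have "\<forall>\<phi>\<in>\<theta> ` K. mv_algebra (quot_mv A \<phi>) \<and> simple_mv (quot_mv A \<phi>)"
    using simple mv_algebra_quot[OF A cong] by blast
  ultimately show ?thesis unfolding semisimple_mv_def by blast
qed

section \<open>Free MV-algebras\<close>

datatype (vars: 'i) mv_term =
  MVar 'i | MZero | MPlus "'i mv_term" "'i mv_term" | MNeg "'i mv_term"

definition term_alg :: "'i set \<Rightarrow> 'i mv_term mv" where
  "term_alg I = \<lparr>carrier = {t. vars t \<subseteq> I}, mv_plus = MPlus, mv_zero = MZero, mv_neg = MNeg\<rparr>"

inductive_set mv_axioms :: "'i set \<Rightarrow> 'i mv_term rel" for I where
  "\<lbrakk>vars x \<subseteq> I; vars y \<subseteq> I; vars z \<subseteq> I\<rbrakk> \<Longrightarrow>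
     (MPlus (MPlus x y) z, MPlus x (MPlus y z)) \<in> mv_axioms I"
| "\<lbrakk>vars x \<subseteq> I; vars y \<subseteq> I\<rbrakk> \<Longrightarrow> (MPlus x y, MPlus y x) \<in> mv_axioms I"
| "vars x \<subseteq> I \<Longrightarrow> (MPlus MZero x, x) \<in> mv_axioms I"
| "vars x \<subseteq> I \<Longrightarrow> (MNeg (MNeg x), x) \<in> mv_axioms I"
| "vars x \<subseteq> I \<Longrightarrow> (MPlus x (MNeg MZero), MNeg MZero) \<in> mv_axioms I"
| "\<lbrakk>vars x \<subseteq> I; vars y \<subseteq> I\<rbrakk> \<Longrightarrow>
     (MPlus x (MNeg (MPlus x (MNeg y))), MPlus y (MNeg (MPlus y (MNeg x)))) \<in> mv_axioms I"

definition free_mv :: "'i set \<Rightarrow> 'i mv_term set mv" where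
  "free_mv I = quot_mv (term_alg I) (cong_gen (term_alg I) (mv_axioms I))"

definition gen :: "'i set \<Rightarrow> 'i \<Rightarrow> 'i mv_term set" where
  "gen I i = cong_gen (term_alg I) (mv_axioms I) `` {MVar i}"

abbreviation term_cong :: "'i set \<Rightarrow> 'i mv_term rel" where
  "term_cong I \<equiv> cong_gen (term_alg I) (mv_axioms I)"

lemma congruence_term_cong: "congruence (term_alg I) (term_cong I)"
  by (rule congruence_cong_gen) (auto simp: term_alg_def elim!: mv_axioms.cases)

lemma mv_algebra_free: "mv_algebra (free_mv I)"
proof -
  note c = congruence_term_cong[of I]
  note q = quot_mv_ops[OF c, unfolded term_alg_def, simplified, folded term_alg_def]
  have ax: "(s, t) \<in> mv_axioms I \<Longrightarrow> term_cong I `` {s} = term_cong I `` {t}" for s t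
    using cong_gen_incl equiv_class_eq[OF congruenceD(1)[OF c]] by blast
  show ?thesis
    unfolding free_mv_def
  proof (rule mv_algebraI, unfold q(1))
    fix X Y Z
    assume "X \<in> (\<lambda>t. term_cong I `` {t}) ` {t. vars t \<subseteq> I}"
      "Y \<in> (\<lambda>t. term_cong I `` {t}) ` {t. vars t \<subseteq> I}"
      "Z \<in> (\<lambda>t. term_cong I `` {t}) ` {t. vars t \<subseteq> I}"
    then obtain x y z where *: "X = term_cong I `` {x}" "Y = term_cong I `` {y}"
      "Z = term_cong I `` {z}" "vars x \<subseteq> I" "vars y \<subseteq> I" "vars z \<subseteq> I"
      by blast
    let ?F = "quot_mv (term_alg I) (term_cong I)"
    show "(X \<oplus>\<^bsub>?F\<^esub> Y) \<oplus>\<^bsub>?F\<^esub> Z = X \<oplus>\<^bsub>?F\<^esub> (Y \<oplus>\<^bsub>?F\<^esub> Z)"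
      using ax[OF mv_axioms.intros(1)[OF *(4-6)]] * by (simp add: q)
    show "X \<oplus>\<^bsub>?F\<^esub> Y = Y \<oplus>\<^bsub>?F\<^esub> X"
      using ax[OF mv_axioms.intros(2)[OF *(4,5)]] * by (simp add: q)
    show "\<zero>\<^bsub>?F\<^esub> \<oplus>\<^bsub>?F\<^esub> X = X"
      using ax[OF mv_axioms.intros(3)[OF *(4)]] * by (simp add: q)
    show "\<sim>\<^bsub>?F\<^esub> (\<sim>\<^bsub>?F\<^esub> X) = X"
      using ax[OF mv_axioms.intros(4)[OF *(4)]] * by (simp add: q)
    show "X \<oplus>\<^bsub>?F\<^esub> \<sim>\<^bsub>?F\<^esub> \<zero>\<^bsub>?F\<^esub> = \<sim>\<^bsub>?F\<^esub> \<zero>\<^bsub>?F\<^esub>"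
      using ax[OF mv_axioms.intros(5)[OF *(4)]] * by (simp add: q)
    show "X \<oplus>\<^bsub>?F\<^esub> \<sim>\<^bsub>?F\<^esub> (X \<oplus>\<^bsub>?F\<^esub> \<sim>\<^bsub>?F\<^esub> Y) = Y \<oplus>\<^bsub>?F\<^esub> \<sim>\<^bsub>?F\<^esub> (Y \<oplus>\<^bsub>?F\<^esub> \<sim>\<^bsub>?F\<^esub> X)"
      using ax[OF mv_axioms.intros(6)[OF *(4,5)]] * by (simp add: q)
  qed (auto simp: q)
qed

text \<open>The universal property of \<open>free_mv I\<close>, for all MV-algebras \<open>A\<close>.\<close>

lemma free_mv_universal:
  assumes A: "mv_algebra A" and p: "\<And>i. i \<in> I \<Longrightarrow> p i \<in> carrier A"
  shows "\<exists>!h. h \<in> mv_hom (free_mv I) A \<and> (\<forall>i\<in>I. h (gen I i) = p i)"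
proof -
  define ev where "ev = rec_mv_term p \<zero>\<^bsub>A\<^esub> (\<lambda>_ _ x y. x \<oplus>\<^bsub>A\<^esub> y) (\<lambda>_ x. \<sim>\<^bsub>A\<^esub> x)"
  have ev [simp]: "ev (MVar i) = p i" "ev MZero = \<zero>\<^bsub>A\<^esub>"
      "ev (MPlus s t) = ev s \<oplus>\<^bsub>A\<^esub> ev t" "ev (MNeg t) = \<sim>\<^bsub>A\<^esub> (ev t)" for i s t
    by (simp_all add: ev_def)
  note d = mv_algebraD[OF A]
  have ax: "x \<in> carrier A \<Longrightarrow> \<sim>\<^bsub>A\<^esub> (\<sim>\<^bsub>A\<^esub> x) = x"
    "x \<in> carrier A \<Longrightarrow> x \<oplus>\<^bsub>A\<^esub> \<sim>\<^bsub>A\<^esub> \<zero>\<^bsub>A\<^esub> = \<sim>\<^bsub>A\<^esub> \<zero>\<^bsub>A\<^esub>"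
    "x \<in> carrier A \<Longrightarrow> y \<in> carrier A \<Longrightarrow>
      x \<oplus>\<^bsub>A\<^esub> \<sim>\<^bsub>A\<^esub> (x \<oplus>\<^bsub>A\<^esub> \<sim>\<^bsub>A\<^esub> y) = y \<oplus>\<^bsub>A\<^esub> \<sim>\<^bsub>A\<^esub> (y \<oplus>\<^bsub>A\<^esub> \<sim>\<^bsub>A\<^esub> x)" for x y
    using A unfolding mv_algebra_def by blast+
  have ev_in: "vars t \<subseteq> I \<Longrightarrow> ev t \<in> carrier A" for t
    by (induction t) (auto simp: p d(1-3))
  let ?T = "term_alg I"
  let ?k = "{(s, t). vars s \<subseteq> I \<and> vars t \<subseteq> I \<and> ev s = ev t}"
  have "congruence ?T ?k"
    unfolding congruence_def
    by (auto simp: term_alg_def equiv_def refl_on_def sym_def trans_def)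
  moreover have "(s, t) \<in> ?k" if "(s, t) \<in> mv_axioms I" for s t
    using that
  proof cases
    case (1 x y z) then show ?thesis using ev_in d(4) by auto
  next
    case (2 x y) then show ?thesis using ev_in d(5) by auto
  next
    case 3 then show ?thesis using ev_in d(6) by auto
  next
    case 4 then show ?thesis using ev_in ax(1) by auto
  next
    case (5 x) then show ?thesis using ev_in ax(2) by auto
  next
    case (6 x y) then show ?thesis using ev_in ax(3) by auto
  qed
  then have "mv_axioms I \<subseteq> ?k" by auto
  ultimately have k: "term_cong I \<subseteq> ?k" by (rule cong_gen_least)
  note c = congruence_term_cong[of I]
  note q = quot_mv_ops[OF c, unfolded term_alg_def, simplified,
      folded term_alg_def, folded free_mv_def]
  let ?cl = "\<lambda>t. term_cong I `` {t}"
  define h where "h = (\<lambda>X\<in>carrier (free_mv I). ev (SOME t. t \<in> X))"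
  have h: "h (?cl t) = ev t" if t: "vars t \<subseteq> I" for t
  proof -
    have "t \<in> ?cl t"
      using t congruenceD(1)[OF c] by (auto simp: equiv_def refl_on_def term_alg_def)
    then have "(SOME s. s \<in> ?cl t) \<in> ?cl t" by (rule someI)
    then have "ev (SOME s. s \<in> ?cl t) = ev t" using k by auto
    then show ?thesis using t by (simp add: h_def q(1))
  qed
  have hom: "h \<in> mv_hom (free_mv I) A"
    unfolding mv_hom_def
  proof (intro CollectI conjI ballI)
    show "h \<in> carrier (free_mv I) \<rightarrow>\<^sub>E carrier A"
    proof (rule PiE_I)
      fix X assume "X \<in> carrier (free_mv I)"
      then show "h X \<in> carrier A" using h ev_in by (auto simp: q(1))
    qed (simp add: h_def)
  qed (use h in \<open>auto simp: q\<close>)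
  show ?thesis
  proof (rule ex1I[of _ h])
    show "h \<in> mv_hom (free_mv I) A \<and> (\<forall>i\<in>I. h (gen I i) = p i)"
      using hom h by (simp add: gen_def)
  next
    fix g assume g: "g \<in> mv_hom (free_mv I) A \<and> (\<forall>i\<in>I. g (gen I i) = p i)"
    have "g (?cl t) = ev t" if "vars t \<subseteq> I" for t
      using that
    proof (induction t)
      case (MVar i) then show ?case using g by (simp add: gen_def)
    next
      case MZero show ?case using g by (simp add: mv_hom_def q(2))
    next
      case (MPlus s t)
      then have "?cl s \<in> carrier (free_mv I)" "?cl t \<in> carrier (free_mv I)"
        by (auto simp: q(1))
      with g have "g (?cl s \<oplus>\<^bsub>free_mv I\<^esub> ?cl t) = g (?cl s) \<oplus>\<^bsub>A\<^esub> g (?cl t)"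
        by (simp add: mv_hom_def)
      with MPlus show ?case by (simp add: q(4))
    next
      case (MNeg t)
      then have "?cl t \<in> carrier (free_mv I)" by (auto simp: q(1))
      with g have "g (\<sim>\<^bsub>free_mv I\<^esub> ?cl t) = \<sim>\<^bsub>A\<^esub> (g (?cl t))"
        by (simp add: mv_hom_def)
      with MNeg show ?case by (simp add: q(3))
    qed
    then have "g X = h X" if "X \<in> carrier (free_mv I)" for X
      using that h by (auto simp: q(1))
    moreover have "g \<in> extensional (carrier (free_mv I))" "h \<in> extensional (carrier (free_mv I))"
      using g hom by (auto simp: mv_hom_def PiE_def)
    ultimately show "g = h" by (meson extensionalityI)
  qed
qed

text \<open>\<open>bar I p\<close> is the homomorphism \<open>\<F>(I) \<rightarrow> [0,1]\<close> extending \<open>p\<close>; existence and uniqueness follow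
  from \<open>free_mv_universal\<close>, as \<open>std_mv\<close> is an MV-algebra.\<close>

definition bar :: "'i set \<Rightarrow> ('i \<Rightarrow> real) \<Rightarrow> 'i mv_term set \<Rightarrow> real" where
  "bar I p = (THE h. h \<in> mv_hom (free_mv I) std_mv \<and> (\<forall>i\<in>I. h (gen I i) = p i))"

section \<open>The spectrum and definable maps\<close>

definition cube :: "'i set \<Rightarrow> ('i \<Rightarrow> real) set"
  where "cube I = I \<rightarrow>\<^sub>E {0..1}"

definition mv_W :: "'a mv \<Rightarrow> ('a \<Rightarrow> real) set"
  where "mv_W A = mv_hom A std_mv"

definition definable ::
  "'i set \<Rightarrow> ('i \<Rightarrow> real) set \<Rightarrow> 'j set \<Rightarrow> ('j \<Rightarrow> real) set \<Rightarrow> (('i \<Rightarrow> real) \<Rightarrow> 'j \<Rightarrow> real) \<Rightarrow> bool" where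
  "definable I P J Q \<eta> \<longleftrightarrow> \<eta> \<in> P \<rightarrow> Q \<and>
     (\<exists>t. (\<forall>j\<in>J. t j \<in> carrier (free_mv I)) \<and> (\<forall>p\<in>P. \<forall>j\<in>J. \<eta> p j = bar I p (t j)))"

definition Z_homeomorphic ::
  "'i set \<Rightarrow> ('i \<Rightarrow> real) set \<Rightarrow> 'j set \<Rightarrow> ('j \<Rightarrow> real) set \<Rightarrow> bool" where
  "Z_homeomorphic I P J Q \<longleftrightarrow> P \<subseteq> cube I \<and> Q \<subseteq> cube J \<and>
     (\<exists>\<eta>. bij_betw \<eta> P Q \<and> definable I P J Q \<eta> \<and> definable J Q I P (inv_into P \<eta>))"

section \<open>The semisimple tensor product\<close>

abbreviation pair_gen :: "'a mv \<Rightarrow> 'b mv \<Rightarrow> 'a \<Rightarrow> 'b \<Rightarrow> ('a \<times> 'b) mv_term set" where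
  "pair_gen A B a b \<equiv> gen (carrier A \<times> carrier B) (a, b)"

abbreviation free_on_pairs :: "'a mv \<Rightarrow> 'b mv \<Rightarrow> ('a \<times> 'b) mv_term set mv" where
  "free_on_pairs A B \<equiv> free_mv (carrier A \<times> carrier B)"

inductive_set tensor_rels :: "'a mv \<Rightarrow> 'b mv \<Rightarrow> ('a \<times> 'b) mv_term set rel"
  for A :: "'a mv" and B :: "'b mv" where
  one: "(pair_gen A B (mv_one A) (mv_one B), mv_one (free_on_pairs A B)) \<in> tensor_rels A B"
| zero_right: "a \<in> carrier A \<Longrightarrow>
    (pair_gen A B a \<zero>\<^bsub>B\<^esub>, \<zero>\<^bsub>free_on_pairs A B\<^esub>) \<in> tensor_rels A B"
| zero_left: "b \<in> carrier B \<Longrightarrow>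
    (pair_gen A B \<zero>\<^bsub>A\<^esub> b, \<zero>\<^bsub>free_on_pairs A B\<^esub>) \<in> tensor_rels A B"
| sup_right: "\<lbrakk>a \<in> carrier A; b1 \<in> carrier B; b2 \<in> carrier B\<rbrakk> \<Longrightarrow>
    (pair_gen A B a (b1 \<curlyvee>\<^bsub>B\<^esub> b2),
     pair_gen A B a b1 \<curlyvee>\<^bsub>free_on_pairs A B\<^esub> pair_gen A B a b2) \<in> tensor_rels A B"
| sup_left: "\<lbrakk>a1 \<in> carrier A; a2 \<in> carrier A; b \<in> carrier B\<rbrakk> \<Longrightarrow>
    (pair_gen A B (a1 \<curlyvee>\<^bsub>A\<^esub> a2) b,
     pair_gen A B a1 b \<curlyvee>\<^bsub>free_on_pairs A B\<^esub> pair_gen A B a2 b) \<in> tensor_rels A B"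
| inf_right: "\<lbrakk>a \<in> carrier A; b1 \<in> carrier B; b2 \<in> carrier B\<rbrakk> \<Longrightarrow>
    (pair_gen A B a (b1 \<curlywedge>\<^bsub>B\<^esub> b2),
     pair_gen A B a b1 \<curlywedge>\<^bsub>free_on_pairs A B\<^esub> pair_gen A B a b2) \<in> tensor_rels A B"
| inf_left: "\<lbrakk>a1 \<in> carrier A; a2 \<in> carrier A; b \<in> carrier B\<rbrakk> \<Longrightarrow>
    (pair_gen A B (a1 \<curlywedge>\<^bsub>A\<^esub> a2) b,
     pair_gen A B a1 b \<curlywedge>\<^bsub>free_on_pairs A B\<^esub> pair_gen A B a2 b) \<in> tensor_rels A B"
| odot_right: "\<lbrakk>a \<in> carrier A; b1 \<in> carrier B; b2 \<in> carrier B; b1 \<odot>\<^bsub>B\<^esub> b2 = \<zero>\<^bsub>B\<^esub>\<rbrakk> \<Longrightarrow>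
    (pair_gen A B a b1 \<odot>\<^bsub>free_on_pairs A B\<^esub> pair_gen A B a b2,
     \<zero>\<^bsub>free_on_pairs A B\<^esub>) \<in> tensor_rels A B"
| plus_right: "\<lbrakk>a \<in> carrier A; b1 \<in> carrier B; b2 \<in> carrier B; b1 \<odot>\<^bsub>B\<^esub> b2 = \<zero>\<^bsub>B\<^esub>\<rbrakk> \<Longrightarrow>
    (pair_gen A B a (b1 \<oplus>\<^bsub>B\<^esub> b2),
     pair_gen A B a b1 \<oplus>\<^bsub>free_on_pairs A B\<^esub> pair_gen A B a b2) \<in> tensor_rels A B"
| odot_left: "\<lbrakk>a1 \<in> carrier A; a2 \<in> carrier A; b \<in> carrier B; a1 \<odot>\<^bsub>A\<^esub> a2 = \<zero>\<^bsub>A\<^esub>\<rbrakk> \<Longrightarrow>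
    (pair_gen A B a1 b \<odot>\<^bsub>free_on_pairs A B\<^esub> pair_gen A B a2 b,
     \<zero>\<^bsub>free_on_pairs A B\<^esub>) \<in> tensor_rels A B"
| plus_left: "\<lbrakk>a1 \<in> carrier A; a2 \<in> carrier A; b \<in> carrier B; a1 \<odot>\<^bsub>A\<^esub> a2 = \<zero>\<^bsub>A\<^esub>\<rbrakk> \<Longrightarrow>
    (pair_gen A B (a1 \<oplus>\<^bsub>A\<^esub> a2) b,
     pair_gen A B a1 b \<oplus>\<^bsub>free_on_pairs A B\<^esub> pair_gen A B a2 b) \<in> tensor_rels A B"

definition mv_tensor :: "'a mv \<Rightarrow> 'b mv \<Rightarrow> ('a \<times> 'b) mv_term set set mv" where
  "mv_tensor A B =
     quot_mv (free_on_pairs A B) (cong_gen (free_on_pairs A B) (tensor_rels A B))"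

definition ss_tensor :: "'a mv \<Rightarrow> 'b mv \<Rightarrow> ('a \<times> 'b) mv_term set set set mv" where
  "ss_tensor A B = quot_mv (mv_tensor A B) (radical (mv_tensor A B))"

definition cube_mult :: "'a mv \<Rightarrow> 'b mv \<Rightarrow> ('a \<Rightarrow> real) \<times> ('b \<Rightarrow> real) \<Rightarrow> 'a \<times> 'b \<Rightarrow> real" where
  "cube_mult A B = (\<lambda>(f, g). \<lambda>(a, b)\<in>carrier A \<times> carrier B. f a * g b)"

end

(* Homomorphisms of the tensor product to [0,1] are the bimorphisms p : A x B -> [0,1], since the
   kernel of a homomorphism to [0,1] is maximal and so contains the radical.  Bimorphisms are
   exactly the products f g of homomorphisms: with f = p(_,1) and g = p(1,_), whenever g b > 0 the
   map p(_,b) / g b is a homomorphism that vanishes where f does, because p(a,b) <= p(a,1).  But a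
   homomorphism to [0,1] is determined by its zero set, so p(_,b) / g b = f.  Restriction to the
   generators is thus a bijection onto the set of products; it is definable by variables, and its
   inverse by representatives in the free algebra of the elements of the tensor product. *)

theory Submission
  imports Defs
begin

section \<open>Elementary facts on extensional MV-homomorphisms\<close>

lemma mv_hom_closed: "h \<in> mv_hom A B \<Longrightarrow> x \<in> carrier A \<Longrightarrow> h x \<in> carrier B"
  by (auto simp: mv_hom_def)

lemma mv_homD:
  assumes "h \<in> mv_hom A B"
  shows "h \<zero>\<^bsub>A\<^esub> = \<zero>\<^bsub>B\<^esub>"
    and "x \<in> carrier A \<Longrightarrow> h (\<sim>\<^bsub>A\<^esub> x) = \<sim>\<^bsub>B\<^esub> (h x)"
    and "x \<in> carrier A \<Longrightarrow> y \<in> carrier A \<Longrightarrow> h (x \<oplus>\<^bsub>A\<^esub> y) = h x \<oplus>\<^bsub>B\<^esub> h y"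
  using assms by (auto simp: mv_hom_def)

lemma mv_hom_eqI:
  assumes "h \<in> mv_hom A B" "k \<in> mv_hom A B" "\<And>x. x \<in> carrier A \<Longrightarrow> h x = k x"
  shows "h = k"
  using assms by (auto simp: mv_hom_def intro: PiE_ext)

section \<open>Arithmetic in MV-algebras\<close>

lemma mv_algebra_derived:
  assumes A: "mv_algebra A"
  shows mv_one_closed: "mv_one A \<in> carrier A"
    and mv_neg_neg: "x \<in> carrier A \<Longrightarrow> \<sim>\<^bsub>A\<^esub> (\<sim>\<^bsub>A\<^esub> x) = x"
    and mv_neg_one: "\<sim>\<^bsub>A\<^esub> mv_one A = \<zero>\<^bsub>A\<^esub>"
    and mv_plus_zero: "x \<in> carrier A \<Longrightarrow> x \<oplus>\<^bsub>A\<^esub> \<zero>\<^bsub>A\<^esub> = x"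
    and mv_plus_one: "x \<in> carrier A \<Longrightarrow> x \<oplus>\<^bsub>A\<^esub> mv_one A = mv_one A"
    and mv_plus_neg: "x \<in> carrier A \<Longrightarrow> x \<oplus>\<^bsub>A\<^esub> \<sim>\<^bsub>A\<^esub> x = mv_one A"
    and mv_odot_closed: "x \<in> carrier A \<Longrightarrow> y \<in> carrier A \<Longrightarrow> x \<odot>\<^bsub>A\<^esub> y \<in> carrier A"
    and mv_sup_closed: "x \<in> carrier A \<Longrightarrow> y \<in> carrier A \<Longrightarrow> x \<curlyvee>\<^bsub>A\<^esub> y \<in> carrier A"
    and mv_inf_closed: "x \<in> carrier A \<Longrightarrow> y \<in> carrier A \<Longrightarrow> x \<curlywedge>\<^bsub>A\<^esub> y \<in> carrier A"
proof -
  note d = mv_algebraD[OF A]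
  have neg: "\<sim>\<^bsub>A\<^esub> (\<sim>\<^bsub>A\<^esub> x) = x" if "x \<in> carrier A" for x
    using A that by (simp add: mv_algebra_def)
  have one: "x \<oplus>\<^bsub>A\<^esub> mv_one A = mv_one A" if "x \<in> carrier A" for x
    using A that by (simp add: mv_algebra_def mv_one_def)
  have luk: "x \<oplus>\<^bsub>A\<^esub> \<sim>\<^bsub>A\<^esub> (x \<oplus>\<^bsub>A\<^esub> \<sim>\<^bsub>A\<^esub> y) = y \<oplus>\<^bsub>A\<^esub> \<sim>\<^bsub>A\<^esub> (y \<oplus>\<^bsub>A\<^esub> \<sim>\<^bsub>A\<^esub> x)"
    if "x \<in> carrier A" "y \<in> carrier A" for x y
    using A that by (simp add: mv_algebra_def)
  show o: "mv_one A \<in> carrier A" by (simp add: mv_one_def d)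
  show n1: "\<sim>\<^bsub>A\<^esub> mv_one A = \<zero>\<^bsub>A\<^esub>" by (simp add: mv_one_def d neg)
  show zero: "x \<oplus>\<^bsub>A\<^esub> \<zero>\<^bsub>A\<^esub> = x" if "x \<in> carrier A" for x
    using d(1,5,6) that by metis
  show "\<sim>\<^bsub>A\<^esub> (\<sim>\<^bsub>A\<^esub> x) = x" "x \<oplus>\<^bsub>A\<^esub> mv_one A = mv_one A" if "x \<in> carrier A"
    using neg one that by auto
  show "x \<oplus>\<^bsub>A\<^esub> \<sim>\<^bsub>A\<^esub> x = mv_one A" if x: "x \<in> carrier A"
    \<comment> \<open>The last MV-axiom with \<open>y = mv_one A\<close>: its left side reduces to x
      \<oplus> \<sim>x, its right side to 1.\<close>
    using luk[OF x o] x o d(2,3) n1 zero one d(5) by metis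
  show "x \<odot>\<^bsub>A\<^esub> y \<in> carrier A" "x \<curlyvee>\<^bsub>A\<^esub> y \<in> carrier A" "x \<curlywedge>\<^bsub>A\<^esub> y \<in> carrier A"
    if "x \<in> carrier A" "y \<in> carrier A"
    using that by (simp_all add: odot_def mv_sup_def mv_inf_def d)
qed

lemma mv_sup_one:
  assumes "mv_algebra A" "x \<in> carrier A"
  shows "x \<curlyvee>\<^bsub>A\<^esub> mv_one A = mv_one A"
  using assms by (simp add: mv_sup_def mv_plus_one mv_one_closed mv_algebraD(2,3))

lemma mv_odot_neg:
  assumes "mv_algebra A" "x \<in> carrier A"
  shows "x \<odot>\<^bsub>A\<^esub> \<sim>\<^bsub>A\<^esub> x = \<zero>\<^bsub>A\<^esub>"
  using assms by (simp add: odot_def mv_plus_neg mv_neg_one mv_algebraD(2))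

text \<open>Any sum can be rewritten as a sum of disjoint elements, so a map known to be additive on
  disjoint elements only is still controlled on all sums. Both claims come from writing the meet as
  \<sim>(x \<oplus> \<sim>s), where s is the full sum.\<close>

lemma mv_plus_disjoint:
  assumes A: "mv_algebra A" and x: "x \<in> carrier A" and y: "y \<in> carrier A"
  shows "x \<odot>\<^bsub>A\<^esub> (\<sim>\<^bsub>A\<^esub> x \<curlywedge>\<^bsub>A\<^esub> y) = \<zero>\<^bsub>A\<^esub>"
    and "x \<oplus>\<^bsub>A\<^esub> (\<sim>\<^bsub>A\<^esub> x \<curlywedge>\<^bsub>A\<^esub> y) = x \<oplus>\<^bsub>A\<^esub> y"
proof -
  note d = mv_algebraD[OF A] and e = mv_algebra_derived[OF A]
  have luk: "u \<oplus>\<^bsub>A\<^esub> \<sim>\<^bsub>A\<^esub> (u \<oplus>\<^bsub>A\<^esub> \<sim>\<^bsub>A\<^esub> v) = v \<oplus>\<^bsub>A\<^esub> \<sim>\<^bsub>A\<^esub> (v \<oplus>\<^bsub>A\<^esub> \<sim>\<^bsub>A\<^esub> u)"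
    if "u \<in> carrier A" "v \<in> carrier A" for u v
    using A that by (simp add: mv_algebra_def)
  define s where "s = x \<oplus>\<^bsub>A\<^esub> y"
  have s: "s \<in> carrier A" by (simp add: s_def x y d)
  have "\<sim>\<^bsub>A\<^esub> (\<sim>\<^bsub>A\<^esub> x \<oplus>\<^bsub>A\<^esub> \<sim>\<^bsub>A\<^esub> y) \<oplus>\<^bsub>A\<^esub> \<sim>\<^bsub>A\<^esub> y
      = \<sim>\<^bsub>A\<^esub> y \<oplus>\<^bsub>A\<^esub> \<sim>\<^bsub>A\<^esub> (\<sim>\<^bsub>A\<^esub> y \<oplus>\<^bsub>A\<^esub> \<sim>\<^bsub>A\<^esub> x)"
    using x y d(2,3,5) by metis
  also have "\<dots> = x \<oplus>\<^bsub>A\<^esub> \<sim>\<^bsub>A\<^esub> s"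
    using luk[of "\<sim>\<^bsub>A\<^esub> y" x] x y by (simp add: d e s_def)
  finally have inf: "\<sim>\<^bsub>A\<^esub> x \<curlywedge>\<^bsub>A\<^esub> y = \<sim>\<^bsub>A\<^esub> (x \<oplus>\<^bsub>A\<^esub> \<sim>\<^bsub>A\<^esub> s)"
    using x y by (simp add: mv_inf_def mv_sup_def d e)
  have "\<sim>\<^bsub>A\<^esub> x \<oplus>\<^bsub>A\<^esub> (x \<oplus>\<^bsub>A\<^esub> \<sim>\<^bsub>A\<^esub> s) = (x \<oplus>\<^bsub>A\<^esub> \<sim>\<^bsub>A\<^esub> x) \<oplus>\<^bsub>A\<^esub> \<sim>\<^bsub>A\<^esub> s"
    using d(2-5) x s by metis
  also have "\<dots> = mv_one A"
    using x s d(2,5) e(1,5,6) by metis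
  finally show "x \<odot>\<^bsub>A\<^esub> (\<sim>\<^bsub>A\<^esub> x \<curlywedge>\<^bsub>A\<^esub> y) = \<zero>\<^bsub>A\<^esub>"
    using x s by (simp add: odot_def inf d e)
  have "s \<oplus>\<^bsub>A\<^esub> \<sim>\<^bsub>A\<^esub> x = y \<oplus>\<^bsub>A\<^esub> (x \<oplus>\<^bsub>A\<^esub> \<sim>\<^bsub>A\<^esub> x)"
    unfolding s_def using d(2-5) x y by metis
  then have "s \<oplus>\<^bsub>A\<^esub> \<sim>\<^bsub>A\<^esub> x = mv_one A" using x y by (simp add: e)
  \<comment> \<open>The last MV-axiom turns the left side into s \<oplus> \<sim>(s \<oplus>
    \<sim>x), and the second summand is \<sim>1 = 0.\<close>
  then show "x \<oplus>\<^bsub>A\<^esub> (\<sim>\<^bsub>A\<^esub> x \<curlywedge>\<^bsub>A\<^esub> y) = x \<oplus>\<^bsub>A\<^esub> y"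
    using luk[OF x s] s by (simp add: inf e flip: s_def)
qed

section \<open>Homomorphisms to the standard MV-algebra\<close>

lemma mv_WI:
  assumes "h \<in> carrier A \<rightarrow>\<^sub>E {0..1}" "h \<zero>\<^bsub>A\<^esub> = 0"
    and "\<And>x. x \<in> carrier A \<Longrightarrow> h (\<sim>\<^bsub>A\<^esub> x) = 1 - h x"
    and "\<And>x y. x \<in> carrier A \<Longrightarrow> y \<in> carrier A \<Longrightarrow> h (x \<oplus>\<^bsub>A\<^esub> y) = min (h x + h y) 1"
  shows "h \<in> mv_W A"
  using assms by (simp add: mv_W_def mv_hom_def std_mv_def)

lemma mv_W_bounds:
  assumes "h \<in> mv_W A" "x \<in> carrier A"
  shows "0 \<le> h x" "h x \<le> 1"
  using mv_hom_closed[of h A std_mv x] assms by (auto simp: mv_W_def std_mv_def)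

lemma mv_W_ops:
  assumes A: "mv_algebra A" and h: "h \<in> mv_W A"
  shows mv_W_zero: "h \<zero>\<^bsub>A\<^esub> = 0"
    and mv_W_one: "h (mv_one A) = 1"
    and mv_W_neg: "x \<in> carrier A \<Longrightarrow> h (\<sim>\<^bsub>A\<^esub> x) = 1 - h x"
    and mv_W_plus: "x \<in> carrier A \<Longrightarrow> y \<in> carrier A \<Longrightarrow> h (x \<oplus>\<^bsub>A\<^esub> y) = min (h x + h y) 1"
    and mv_W_odot: "x \<in> carrier A \<Longrightarrow> y \<in> carrier A \<Longrightarrow> h (x \<odot>\<^bsub>A\<^esub> y) = max 0 (h x + h y - 1)"
    and mv_W_sup: "x \<in> carrier A \<Longrightarrow> y \<in> carrier A \<Longrightarrow> h (x \<curlyvee>\<^bsub>A\<^esub> y) = max (h x) (h y)"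
    and mv_W_inf: "x \<in> carrier A \<Longrightarrow> y \<in> carrier A \<Longrightarrow> h (x \<curlywedge>\<^bsub>A\<^esub> y) = min (h x) (h y)"
proof -
  note d = mv_algebraD[OF A]
  have zero: "h \<zero>\<^bsub>A\<^esub> = 0"
    and neg: "x \<in> carrier A \<Longrightarrow> h (\<sim>\<^bsub>A\<^esub> x) = 1 - h x"
    and plus: "x \<in> carrier A \<Longrightarrow> y \<in> carrier A \<Longrightarrow> h (x \<oplus>\<^bsub>A\<^esub> y) = min (h x + h y) 1" for x y
    using h by (simp_all add: mv_W_def mv_hom_def std_mv_def)
  show "h \<zero>\<^bsub>A\<^esub> = 0" "h (mv_one A) = 1"
    by (simp_all add: zero mv_one_def neg d)
  show "x \<in> carrier A \<Longrightarrow> h (\<sim>\<^bsub>A\<^esub> x) = 1 - h x"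
    and "x \<in> carrier A \<Longrightarrow> y \<in> carrier A \<Longrightarrow> h (x \<oplus>\<^bsub>A\<^esub> y) = min (h x + h y) 1"
    by (fact neg plus)+
  assume x: "x \<in> carrier A" and y: "y \<in> carrier A"
  note b = mv_W_bounds[OF h x] mv_W_bounds[OF h y]
  show "h (x \<odot>\<^bsub>A\<^esub> y) = max 0 (h x + h y - 1)"
    using b by (simp add: odot_def neg plus d x y)
  have sup: "h (u \<curlyvee>\<^bsub>A\<^esub> v) = max (h u) (h v)" if "u \<in> carrier A" "v \<in> carrier A" for u v
    using mv_W_bounds[OF h that(1)] mv_W_bounds[OF h that(2)]
    by (simp add: mv_sup_def neg plus d that)
  show "h (x \<curlyvee>\<^bsub>A\<^esub> y) = max (h x) (h y)" by (rule sup[OF x y])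
  have "\<sim>\<^bsub>A\<^esub> x \<curlyvee>\<^bsub>A\<^esub> \<sim>\<^bsub>A\<^esub> y \<in> carrier A" by (simp add: mv_sup_def x y d)
  then show "h (x \<curlywedge>\<^bsub>A\<^esub> y) = min (h x) (h y)"
    by (simp add: mv_inf_def neg sup d x y)
qed

text \<open>As long as \<open>u\<close> and \<open>v\<close> lie on the same side of \<open>1/2\<close>, one of the two operations doubles
  their distance; once \<open>1/2\<close> separates them, \<open>\<odot>\<close> sends \<open>u\<close> to \<open>0\<close>.\<close>

lemma doubling_separates:
  fixes u v :: real
  assumes plus: "\<And>u v. P u v \<Longrightarrow> P (min (u + u) 1) (min (v + v) 1)"
    and odot: "\<And>u v. P u v \<Longrightarrow> P (max 0 (u + u - 1)) (max 0 (v + v - 1))"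
    and "P u v" "0 \<le> u" "u < v" "v \<le> 1"
  shows "P 0 1"
proof -
  have ex: "\<exists>n. 1 \<le> 2 ^ n * d" if d: "0 < d" for d :: real
  proof -
    obtain n where "1 / d < 2 ^ n" using real_arch_pow[of 2 "1 / d"] by auto
    then have "1 \<le> 2 ^ n * d" using d by (simp add: divide_simps)
    then show ?thesis ..
  qed
  \<comment> \<open>From u = 0 on, \<oplus> alone suffices: it fixes 0 and doubles w until the
    truncation gives exactly 1.\<close>
  have reach: "P 0 1" if "P 0 w" "0 < w" "w \<le> 1" "1 \<le> 2 ^ n * w" for w n
    using that
  proof (induction n arbitrary: w)
    case 0
    then show ?case by simp
  next
    case (Suc n)
    have *: "P 0 (min (w + w) 1)" using plus[OF Suc.prems(1)] by simp
    show ?case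
    proof (cases "w + w \<ge> 1")
      case True
      then show ?thesis using * by (simp add: min_def split: if_splits)
    next
      case False
      then have "P 0 (w + w)" using * by (simp add: min_def split: if_splits)
      then show ?thesis using Suc False by (intro Suc.IH[of "w + w"]) (auto simp: algebra_simps)
    qed
  qed
  \<comment> \<open>The number n bounds how many doublings the distance needs to reach 1, which
    inside the unit interval forces the pair (0, 1).\<close>
  have "P 0 1" if "P u v" "0 \<le> u" "u < v" "v \<le> 1" "1 \<le> 2 ^ n * (v - u)" for u v n
    using that
  proof (induction n arbitrary: u v)
    case 0
    then have "u = 0" "v = 1" by auto
    then show ?case using 0 by simp
  next
    case (Suc n)
    consider "v \<le> 1/2" | "u \<ge> 1/2" | "u \<le> 1/2" "1/2 < v" by linarith
    then show ?case
    proof cases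
      case 1
      then have "P (u + u) (v + v)"
        using plus[OF Suc.prems(1)] Suc.prems by (simp add: min_def split: if_splits)
      then show ?thesis using Suc.prems 1
        by (intro Suc.IH[of "u + u" "v + v"]) (auto simp: algebra_simps)
    next
      case 2
      then have "P (u + u - 1) (v + v - 1)"
        using odot[OF Suc.prems(1)] Suc.prems by (simp add: max_def split: if_splits)
      then show ?thesis using Suc.prems 2
        by (intro Suc.IH[of "u + u - 1" "v + v - 1"]) (auto simp: algebra_simps)
    next
      case 3
      then have "max 0 (u + u - 1) = 0" "max 0 (v + v - 1) = v + v - 1" by simp_all
      then have "P 0 (v + v - 1)" using odot[OF Suc.prems(1)] by simp
      moreover obtain m where "1 \<le> 2 ^ m * (v + v - 1)" using ex[of "v + v - 1"] 3 by auto
      ultimately show ?thesis using reach 3 Suc.prems by auto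
    qed
  qed
  then show ?thesis using assms(3-) ex[of "v - u"] by auto
qed

text \<open>If h exceeded f somewhere, doubling would lead to an element where f is 0 and h is 1,
  against \<open>null\<close>. Hence h \<le> f, and negation reverses the inequality.\<close>

lemma mv_W_eqI:
  assumes A: "mv_algebra A" and f: "f \<in> mv_W A" and h: "h \<in> mv_W A"
    and null: "\<And>x. x \<in> carrier A \<Longrightarrow> f x = 0 \<Longrightarrow> h x = 0"
  shows "f = h"
proof -
  note d = mv_algebraD[OF A] and F = mv_W_ops[OF A f] and H = mv_W_ops[OF A h]
  have le: "h x \<le> f x" if x: "x \<in> carrier A" for x
  proof (rule ccontr)
    assume *: "\<not> h x \<le> f x"
    \<comment> \<open>P is the set of joint values of f and h. It is closed under both doubling
      operations because y \<oplus> y and y \<odot> y lie in A.\<close>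
    define P where "P u v \<longleftrightarrow> (\<exists>y\<in>carrier A. f y = u \<and> h y = v)" for u v
    have "P 0 1"
    proof (rule doubling_separates)
      show "P (min (u + u) 1) (min (v + v) 1)" if uv: "P u v" for u v
      proof -
        obtain y where "y \<in> carrier A" "f y = u" "h y = v" using uv by (auto simp: P_def)
        then show ?thesis
          unfolding P_def by (intro bexI[of _ "y \<oplus>\<^bsub>A\<^esub> y"]) (simp_all add: F H d)
      qed
      show "P (max 0 (u + u - 1)) (max 0 (v + v - 1))" if uv: "P u v" for u v
      proof -
        obtain y where "y \<in> carrier A" "f y = u" "h y = v" using uv by (auto simp: P_def)
        then show ?thesis
          unfolding P_def
          by (intro bexI[of _ "y \<odot>\<^bsub>A\<^esub> y"]) (simp_all add: F H mv_odot_closed[OF A])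
      qed
      show "P (f x) (h x)" using x by (auto simp: P_def)
    qed (use * mv_W_bounds[OF f x] mv_W_bounds[OF h x] in auto)
    then show False using null by (auto simp: P_def)
  qed
  \<comment> \<open>The inequality at \<sim>x reads 1 - h x \<le> 1 - f x.\<close>
  have "f x = h x" if x: "x \<in> carrier A" for x
    using le[OF x] le[OF d(2)[OF x]] x by (simp add: F H)
  then show ?thesis using f h mv_hom_eqI unfolding mv_W_def by blast
qed

section \<open>Kernels, maximal congruences and the radical\<close>

definition hom_ker :: "'a mv \<Rightarrow> ('a \<Rightarrow> 'b) \<Rightarrow> 'a rel" where
  "hom_ker A h = {(x, y) \<in> carrier A \<times> carrier A. h x = h y}"

lemma congruence_hom_ker:
  assumes "mv_algebra A" "h \<in> mv_hom A B"
  shows "congruence A (hom_ker A h)"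
  using mv_algebraD[OF assms(1)] mv_homD[OF assms(2)]
  by (auto simp: congruence_def hom_ker_def equiv_def refl_on_def sym_def trans_def)

text \<open>A congruence that properly contains the kernel relates two elements with different
  values. Doubling both yields related elements of values 0 and 1; the kernel already identifies
  these with the constants, so 0 and 1 are related and everything collapses.\<close>

lemma maximal_congruence_hom_ker:
  assumes A: "mv_algebra A" and h: "h \<in> mv_W A"
  shows "maximal_congruence A (hom_ker A h)"
  unfolding maximal_congruence_def
proof (intro conjI allI impI)
  note d = mv_algebraD[OF A] and e = mv_algebra_derived[OF A] and H = mv_W_ops[OF A h]
  show "congruence A (hom_ker A h)"
    using congruence_hom_ker[OF A] h by (simp add: mv_W_def)
  have "(\<zero>\<^bsub>A\<^esub>, mv_one A) \<notin> hom_ker A h" by (simp add: hom_ker_def H)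
  then show "hom_ker A h \<noteq> carrier A \<times> carrier A" using d(1) e(1) by auto
  fix \<psi> assume "congruence A \<psi> \<and> hom_ker A h \<subseteq> \<psi>"
  then have \<psi>: "congruence A \<psi>" and sub: "hom_ker A h \<subseteq> \<psi>" by auto
  note c = congruenceD[OF \<psi>]
  have refl: "(x, x) \<in> \<psi>" if "x \<in> carrier A" for x
    using c(1) that by (auto simp: equiv_def refl_on_def)
  have sym: "(y, x) \<in> \<psi>" if "(x, y) \<in> \<psi>" for x y
    using c(1) that by (auto simp: equiv_def sym_def)
  have trans: "(x, z) \<in> \<psi>" if "(x, y) \<in> \<psi>" "(y, z) \<in> \<psi>" for x y z
    using c(1) that unfolding equiv_def trans_def by blast
  show "\<psi> = hom_ker A h \<or> \<psi> = carrier A \<times> carrier A"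
  proof (cases "\<psi> \<subseteq> hom_ker A h")
    case True
    then show ?thesis using sub by blast
  next
    case False
    then obtain x y where "(x, y) \<in> \<psi>" "h x \<noteq> h y"
      using c(2,3) unfolding hom_ker_def by blast
    then obtain x y where xy: "(x, y) \<in> \<psi>" "h x < h y"
      using sym by (metis linorder_neqE)
    define P where "P u v \<longleftrightarrow> (\<exists>(x, y)\<in>\<psi>. h x = u \<and> h y = v)" for u v
    have "P 0 1"
    proof (rule doubling_separates)
      show "P (min (u + u) 1) (min (v + v) 1)" if uv: "P u v" for u v
      proof -
        obtain x y where *: "(x, y) \<in> \<psi>" "h x = u" "h y = v" using uv by (auto simp: P_def)
        then show ?thesis
          unfolding P_def using c(5)[OF *(1,1)] c(2,3)
          by (intro bexI[of _ "(x \<oplus>\<^bsub>A\<^esub> x, y \<oplus>\<^bsub>A\<^esub> y)"]) (auto simp: H)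
      qed
      show "P (max 0 (u + u - 1)) (max 0 (v + v - 1))" if uv: "P u v" for u v
      proof -
        obtain x y where *: "(x, y) \<in> \<psi>" "h x = u" "h y = v" using uv by (auto simp: P_def)
        have "(x \<odot>\<^bsub>A\<^esub> x, y \<odot>\<^bsub>A\<^esub> y) \<in> \<psi>"
          unfolding odot_def using *(1) c(4,5) by blast
        then show ?thesis
          unfolding P_def using * c(2,3)
          by (intro bexI[of _ "(x \<odot>\<^bsub>A\<^esub> x, y \<odot>\<^bsub>A\<^esub> y)"]) (auto simp: H)
      qed
      show "P (h x) (h y)" using xy by (auto simp: P_def)
    qed (use xy mv_W_bounds[OF h] c(2,3) in auto)
    then obtain a b where ab: "(a, b) \<in> \<psi>" "h a = 0" "h b = 1" by (auto simp: P_def)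
    have abc: "a \<in> carrier A" "b \<in> carrier A" using c(2,3) ab(1) by auto
    have "(\<zero>\<^bsub>A\<^esub>, a) \<in> \<psi>" "(b, mv_one A) \<in> \<psi>"
      using sub ab abc d(1) e(1) by (auto simp: hom_ker_def H)
    then have zo: "(\<zero>\<^bsub>A\<^esub>, mv_one A) \<in> \<psi>" using ab(1) trans by blast
    \<comment> \<open>z = z \<oplus> 0 is related to z \<oplus> 1 = 1.\<close>
    have "(z, mv_one A) \<in> \<psi>" if z: "z \<in> carrier A" for z
      using c(5)[OF refl[OF z] zo] z by (simp add: e)
    then have "carrier A \<times> carrier A \<subseteq> \<psi>" using sym trans by blast
    then show ?thesis using c(2,3) by auto
  qed
qed

lemma congruence_radical:
  assumes A: "mv_algebra A"
  shows "congruence A (radical A)"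
proof -
  note d = mv_algebraD[OF A]
  have c: "congruence A \<theta>" if "maximal_congruence A \<theta>" for \<theta>
    using that by (simp add: maximal_congruence_def)
  have refl: "(x, x) \<in> \<theta>" if "congruence A \<theta>" "x \<in> carrier A" for x \<theta>
    using congruenceD(1)[OF that(1)] that(2) by (auto simp: equiv_def refl_on_def)
  have sym: "(y, x) \<in> \<theta>" if "congruence A \<theta>" "(x, y) \<in> \<theta>" for x y \<theta>
    using congruenceD(1)[OF that(1)] that(2) by (auto simp: equiv_def sym_def)
  have trans: "(x, z) \<in> \<theta>" if "congruence A \<theta>" "(x, y) \<in> \<theta>" "(y, z) \<in> \<theta>" for x y z \<theta>
    using congruenceD(1)[OF that(1)] that(2,3) unfolding equiv_def trans_def by blast
  show ?thesis
    unfolding congruence_def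
  proof (intro conjI)
    show sub: "radical A \<subseteq> carrier A \<times> carrier A" by (auto simp: radical_def)
    show "equiv (carrier A) (radical A)"
    proof (rule equivI)
      show "radical A \<subseteq> carrier A \<times> carrier A" by (rule sub)
      show "refl_on (carrier A) (radical A)"
        by (rule refl_onI) (use c refl in \<open>auto simp: radical_def\<close>)
      show "sym (radical A)"
        by (rule symI) (use c sym in \<open>auto simp: radical_def\<close>)
      show "trans (radical A)"
      proof (rule transI)
        fix x y z assume "(x, y) \<in> radical A" "(y, z) \<in> radical A"
        then show "(x, z) \<in> radical A"
          using c trans unfolding radical_def by blast
      qed
    qed
    show "\<forall>(x, x') \<in> radical A. (\<sim>\<^bsub>A\<^esub> x, \<sim>\<^bsub>A\<^esub> x') \<in> radical A"
      using congruenceD(4)[OF c] d(2) by (auto simp: radical_def)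
    show "\<forall>(x, x') \<in> radical A. \<forall>(y, y') \<in> radical A. (x \<oplus>\<^bsub>A\<^esub> y, x' \<oplus>\<^bsub>A\<^esub> y') \<in> radical A"
      using congruenceD(5)[OF c] d(3) by (auto simp: radical_def)
  qed
qed

section \<open>Homomorphisms of quotients and of free algebras\<close>

lemma mv_hom_quot_comp:
  assumes A: "mv_algebra A" and \<theta>: "congruence A \<theta>" and k: "k \<in> mv_hom (quot_mv A \<theta>) B"
  shows "(\<lambda>x\<in>carrier A. k (\<theta> `` {x})) \<in> mv_hom A B"
proof -
  note q = quot_mv_ops[OF \<theta>] and d = mv_algebraD[OF A]
  have cl: "\<theta> `` {x} \<in> carrier (quot_mv A \<theta>)" if "x \<in> carrier A" for x
    using that by (simp add: q)
  show ?thesis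
    unfolding mv_hom_def
  proof (intro CollectI conjI ballI)
    show "(\<lambda>x\<in>carrier A. k (\<theta> `` {x})) \<in> carrier A \<rightarrow>\<^sub>E carrier B"
      using mv_hom_closed[OF k cl] by simp
  qed (use mv_homD[OF k] cl in \<open>simp_all add: d flip: q(2-4)\<close>)
qed

text \<open>The universal property of the quotient. The map evaluates h at a chosen representative,
  and the choice does not matter because h is constant on classes.\<close>

lemma mv_hom_quot_lift:
  assumes A: "mv_algebra A" and \<theta>: "congruence A \<theta>" and h: "h \<in> mv_hom A B"
    and ker: "\<theta> \<subseteq> hom_ker A h"
  obtains k where "k \<in> mv_hom (quot_mv A \<theta>) B" "\<And>x. x \<in> carrier A \<Longrightarrow> k (\<theta> `` {x}) = h x"
proof -
  note q = quot_mv_ops[OF \<theta>] and d = mv_algebraD[OF A]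
  define k where "k = (\<lambda>X\<in>carrier (quot_mv A \<theta>). h (SOME x. x \<in> X))"
  have k: "k (\<theta> `` {x}) = h x" if x: "x \<in> carrier A" for x
  proof -
    have "x \<in> \<theta> `` {x}"
      using x congruenceD(1)[OF \<theta>] by (auto simp: equiv_def refl_on_def)
    then have "(SOME y. y \<in> \<theta> `` {x}) \<in> \<theta> `` {x}" by (rule someI)
    then have "h (SOME y. y \<in> \<theta> `` {x}) = h x" using ker by (auto simp: hom_ker_def)
    then show ?thesis using x by (simp add: k_def q)
  qed
  have "k \<in> mv_hom (quot_mv A \<theta>) B"
    unfolding mv_hom_def
  proof (intro CollectI conjI ballI)
    show "k \<in> carrier (quot_mv A \<theta>) \<rightarrow>\<^sub>E carrier B"
    proof (rule PiE_I)
      show "k X \<in> carrier B" if "X \<in> carrier (quot_mv A \<theta>)" for X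
        using that k mv_hom_closed[OF h] by (auto simp: q)
    qed (simp add: k_def)
  qed (use k d mv_homD[OF h] in \<open>auto simp: q\<close>)
  then show ?thesis using k that by blast
qed

text \<open>The uniqueness half of the universal property of the free algebra;
  \<open>bar_hom\<close> is the existence half.\<close>

lemma bar_eqI:
  assumes "h \<in> mv_W (free_mv I)" "\<And>i. i \<in> I \<Longrightarrow> p i \<in> {0..1}" "\<And>i. i \<in> I \<Longrightarrow> h (gen I i) = p i"
  shows "bar I p = h"
  unfolding bar_def
  by (rule the1_equality[OF free_mv_universal[OF mv_algebra_std]])
    (use assms in \<open>auto simp: mv_W_def std_mv_def\<close>)

lemma bar_hom:
  assumes "\<And>i. i \<in> I \<Longrightarrow> p i \<in> {0..1}"
  shows "bar I p \<in> mv_W (free_mv I)" and "i \<in> I \<Longrightarrow> bar I p (gen I i) = p i"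
proof -
  have "\<And>i. i \<in> I \<Longrightarrow> p i \<in> carrier std_mv" using assms by (simp add: std_mv_def)
  note * = theI'[OF free_mv_universal[of std_mv I p, OF mv_algebra_std this], folded bar_def]
  show "bar I p \<in> mv_W (free_mv I)" "i \<in> I \<Longrightarrow> bar I p (gen I i) = p i"
    using * by (simp_all add: mv_W_def)
qed

lemma gen_closed: "i \<in> I \<Longrightarrow> gen I i \<in> carrier (free_mv I)"
  unfolding gen_def free_mv_def quot_mv_ops(1)[OF congruence_term_cong]
  by (simp add: term_alg_def)

section \<open>Bimorphisms\<close>

text \<open>What the tensor relations impose on a map in one variable while the other is fixed. The
  bound \<open>u x + u y \<le> 1\<close> is the \<odot>-relation read in [0,1], and it makes the
  truncated sum a true sum. The value at 1 is left free, since a section of a bimorphism may send 1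
  to any number in [0,1].\<close>

definition mv_additive :: "'a mv \<Rightarrow> ('a \<Rightarrow> real) \<Rightarrow> bool" where
  "mv_additive A u \<longleftrightarrow> u \<zero>\<^bsub>A\<^esub> = 0 \<and> (\<forall>x\<in>carrier A. \<forall>y\<in>carrier A.
     u (x \<curlyvee>\<^bsub>A\<^esub> y) = max (u x) (u y) \<and> u (x \<curlywedge>\<^bsub>A\<^esub> y) = min (u x) (u y) \<and>
     (x \<odot>\<^bsub>A\<^esub> y = \<zero>\<^bsub>A\<^esub> \<longrightarrow> u x + u y \<le> 1 \<and> u (x \<oplus>\<^bsub>A\<^esub> y) = u x + u y))"

definition bimorphism :: "'a mv \<Rightarrow> 'b mv \<Rightarrow> ('a \<times> 'b \<Rightarrow> real) \<Rightarrow> bool" where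
  "bimorphism A B p \<longleftrightarrow> p (mv_one A, mv_one B) = 1 \<and>
     (\<forall>b\<in>carrier B. mv_additive A (\<lambda>a. p (a, b))) \<and>
     (\<forall>a\<in>carrier A. mv_additive B (\<lambda>b. p (a, b)))"

text \<open>Scaling by c \<ge> 0 commutes with max and min, and sums of disjoint elements are not
  truncated; c \<le> 1 keeps them below 1.\<close>

lemma mv_additive_scaled_hom:
  assumes A: "mv_algebra A" and h: "h \<in> mv_W A" and c: "0 \<le> c" "c \<le> 1"
  shows "mv_additive A (\<lambda>x. c * h x)"
  unfolding mv_additive_def
proof (intro conjI ballI impI)
  note H = mv_W_ops[OF A h]
  show "c * h \<zero>\<^bsub>A\<^esub> = 0" by (simp add: H)
  fix x y assume x: "x \<in> carrier A" and y: "y \<in> carrier A"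
  show "c * h (x \<curlyvee>\<^bsub>A\<^esub> y) = max (c * h x) (c * h y)" "c * h (x \<curlywedge>\<^bsub>A\<^esub> y) = min (c * h x) (c * h y)"
    using c x y by (simp_all add: H max_mult_distrib_left min_mult_distrib_left)
  assume "x \<odot>\<^bsub>A\<^esub> y = \<zero>\<^bsub>A\<^esub>"
  then have le: "h x + h y \<le> 1" using H(5)[OF x y] by (simp add: H)
  then show "c * h (x \<oplus>\<^bsub>A\<^esub> y) = c * h x + c * h y" by (simp add: H x y distrib_left)
  show "c * h x + c * h y \<le> 1"
    using mult_mono[OF c(2) le] c mv_W_bounds[OF h x] mv_W_bounds[OF h y]
    by (simp add: distrib_left)
qed

text \<open>Preservation of joins gives monotonicity, here applied to x \<or> 1 = 1.\<close>

lemma mv_additive_le_one: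
  assumes "mv_algebra A" "mv_additive A u" "x \<in> carrier A"
  shows "u x \<le> u (mv_one A)"
proof -
  have "u (x \<curlyvee>\<^bsub>A\<^esub> mv_one A) = max (u x) (u (mv_one A))"
    using assms mv_one_closed[OF assms(1)] by (simp add: mv_additive_def)
  then show ?thesis using mv_sup_one[OF assms(1,3)] by simp
qed

text \<open>Additivity on the disjoint pair x, \<sim>x determines u on negations, and the disjoint
  form of x \<oplus> y then shows that u turns sums into sums truncated at the value of u at 1.
  Division by this value moves the truncation to 1.\<close>

lemma mv_additive_normalize:
  assumes A: "mv_algebra A" and u: "mv_additive A u"
    and nonneg: "\<And>x. x \<in> carrier A \<Longrightarrow> 0 \<le> u x" and pos: "0 < u (mv_one A)"
  shows "(\<lambda>x\<in>carrier A. u x / u (mv_one A)) \<in> mv_W A"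
proof -
  note d = mv_algebraD[OF A]
  have neg: "u (\<sim>\<^bsub>A\<^esub> x) = u (mv_one A) - u x" if x: "x \<in> carrier A" for x
  proof -
    have "u (x \<oplus>\<^bsub>A\<^esub> \<sim>\<^bsub>A\<^esub> x) = u x + u (\<sim>\<^bsub>A\<^esub> x)"
      using u x d(2)[OF x] mv_odot_neg[OF A x] by (simp add: mv_additive_def)
    then show ?thesis by (simp add: mv_plus_neg[OF A x])
  qed
  have plus: "u (x \<oplus>\<^bsub>A\<^esub> y) = min (u x + u y) (u (mv_one A))"
    if x: "x \<in> carrier A" and y: "y \<in> carrier A" for x y
  proof -
    let ?z = "\<sim>\<^bsub>A\<^esub> x \<curlywedge>\<^bsub>A\<^esub> y"
    have z: "?z \<in> carrier A" by (simp add: mv_inf_closed[OF A] d x y)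
    have "u (x \<oplus>\<^bsub>A\<^esub> y) = u x + u ?z"
      using u x z mv_plus_disjoint[OF A x y] unfolding mv_additive_def by metis
    also have "u ?z = min (u (mv_one A) - u x) (u y)"
      using u x y d(2)[OF x] by (simp add: mv_additive_def neg)
    finally show ?thesis by (simp add: min_add_distrib_right)
  qed
  show ?thesis
  proof (rule mv_WI)
    show "(\<lambda>x\<in>carrier A. u x / u (mv_one A)) \<in> carrier A \<rightarrow>\<^sub>E {0..1}"
      using nonneg pos mv_additive_le_one[OF A u] by (auto simp: divide_simps)
  qed (use u pos in \<open>auto simp: d neg plus mv_additive_def divide_simps min_def\<close>)
qed

text \<open>The factors are the sections of p at the two units. A section at b, once normalized, is
  compared with f through zero sets only.\<close>

lemma bimorphism_factor:
  assumes A: "mv_algebra A" and B: "mv_algebra B" and p: "bimorphism A B p"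
    and nonneg: "\<And>a b. a \<in> carrier A \<Longrightarrow> b \<in> carrier B \<Longrightarrow> 0 \<le> p (a, b)"
  obtains f g where "f \<in> mv_W A" "g \<in> mv_W B"
    "\<And>a b. a \<in> carrier A \<Longrightarrow> b \<in> carrier B \<Longrightarrow> p (a, b) = f a * g b"
proof -
  have one: "p (mv_one A, mv_one B) = 1"
    and left: "\<And>b. b \<in> carrier B \<Longrightarrow> mv_additive A (\<lambda>a. p (a, b))"
    and right: "\<And>a. a \<in> carrier A \<Longrightarrow> mv_additive B (\<lambda>b. p (a, b))"
    using p by (auto simp: bimorphism_def)
  note oA = mv_one_closed[OF A] and oB = mv_one_closed[OF B]
  define f where "f = (\<lambda>a\<in>carrier A. p (a, mv_one B))"
  define g where "g = (\<lambda>b\<in>carrier B. p (mv_one A, b))"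
  have f: "f \<in> mv_W A"
    using mv_additive_normalize[OF A left[OF oB]] nonneg oB by (simp add: one f_def)
  have g: "g \<in> mv_W B"
    using mv_additive_normalize[OF B right[OF oA]] nonneg oA by (simp add: one g_def)
  have "p (a, b) = f a * g b" if a: "a \<in> carrier A" and b: "b \<in> carrier B" for a b
  proof (cases "p (mv_one A, b) = 0")
    case True
    \<comment> \<open>Here p(a,b) lies between 0 and p(1,b) = 0.\<close>
    then show ?thesis
      using mv_additive_le_one[OF A left[OF b] a] nonneg[OF a b] b by (simp add: g_def)
  next
    case False
    then have pos: "0 < p (mv_one A, b)" using nonneg[OF oA b] by simp
    define h where "h = (\<lambda>a\<in>carrier A. p (a, b) / p (mv_one A, b))"
    have "f = h"
    proof (rule mv_W_eqI[OF A f])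
      show "h \<in> mv_W A"
        unfolding h_def using mv_additive_normalize[OF A left[OF b]] nonneg b pos by simp
      \<comment> \<open>Monotonicity in the second variable gives 0 \<le> p(x,b) \<le> p(x,1) = f x
        = 0.\<close>
      show "h x = 0" if "x \<in> carrier A" "f x = 0" for x
        using that mv_additive_le_one[OF B right b] nonneg b by (force simp: f_def h_def)
    qed
    then have "f a = p (a, b) / p (mv_one A, b)" using a by (simp add: h_def)
    then show ?thesis using pos b by (simp add: g_def)
  qed
  then show ?thesis using f g that by blast
qed

text \<open>With one variable fixed, a product is a homomorphism scaled by a constant in
  [0,1].\<close>

lemma bimorphism_mult:
  assumes A: "mv_algebra A" and B: "mv_algebra B" and f: "f \<in> mv_W A" and g: "g \<in> mv_W B"
    and p: "\<And>a b. a \<in> carrier A \<Longrightarrow> b \<in> carrier B \<Longrightarrow> p (a, b) = f a * g b"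
  shows "bimorphism A B p"
proof -
  \<comment> \<open>Closure under the operations makes additivity depend only on values on the
    carrier, which is where p is known to be a product.\<close>
  have cong: "mv_additive C u \<longleftrightarrow> mv_additive C v"
    if "mv_algebra C" "\<And>x. x \<in> carrier C \<Longrightarrow> u x = v x" for C :: "'c mv" and u v
    unfolding mv_additive_def using that
    by (simp add: mv_algebraD mv_sup_closed mv_inf_closed cong: ball_cong)
  have "mv_additive A (\<lambda>a. p (a, b))" if b: "b \<in> carrier B" for b
    using mv_additive_scaled_hom[OF A f mv_W_bounds[OF g b]] cong[OF A, of "\<lambda>a. p (a, b)" "\<lambda>a. g b * f a"]
    by (simp add: p b mult.commute)
  moreover have "mv_additive B (\<lambda>b. p (a, b))" if a: "a \<in> carrier A" for a
    using mv_additive_scaled_hom[OF B g mv_W_bounds[OF f a]] cong[OF B, of "\<lambda>b. p (a, b)" "\<lambda>b. f a * g b"]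
    by (simp add: p a)
  ultimately show ?thesis
    unfolding bimorphism_def
    by (simp add: p mv_one_closed A B mv_W_one[OF A f] mv_W_one[OF B g])
qed

section \<open>The tensor relations and bimorphisms\<close>

lemma tensor_rels_closed:
  assumes A: "mv_algebra A" and B: "mv_algebra B"
  shows "tensor_rels A B \<subseteq> carrier (free_on_pairs A B) \<times> carrier (free_on_pairs A B)"
proof -
  note F = mv_algebra_free[of "carrier A \<times> carrier B"]
  note cl = mv_algebraD(1-3)[OF F] mv_algebra_derived(1,7-9)[OF F]
    mv_algebraD(1-3)[OF A] mv_algebra_derived(1,7-9)[OF A]
    mv_algebraD(1-3)[OF B] mv_algebra_derived(1,7-9)[OF B]
  show ?thesis
  proof (rule subrelI)
    fix s t assume "(s, t) \<in> tensor_rels A B"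
    then show "(s, t) \<in> carrier (free_on_pairs A B) \<times> carrier (free_on_pairs A B)"
      by cases (simp_all add: cl gen_closed)
  qed
qed

text \<open>Since h turns the operations of the free algebra into max, min, truncated sum and
  truncated product of reals, each family of relations becomes one clause of the definition of a
  bimorphism.\<close>

lemma tensor_rels_subset_hom_ker_iff:
  assumes A: "mv_algebra A" and B: "mv_algebra B" and h: "h \<in> mv_W (free_on_pairs A B)"
  shows "tensor_rels A B \<subseteq> hom_ker (free_on_pairs A B) h \<longleftrightarrow>
    bimorphism A B (\<lambda>(a, b). h (pair_gen A B a b))"
proof -
  note F = mv_algebra_free[of "carrier A \<times> carrier B"]
  note H = mv_W_ops[OF F h]
  have G: "pair_gen A B a b \<in> carrier (free_on_pairs A B)" if "a \<in> carrier A" "b \<in> carrier B" for a b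
    using that by (simp add: gen_closed)
  have bd: "h (pair_gen A B a b) \<le> 1" if "a \<in> carrier A" "b \<in> carrier B" for a b
    using mv_W_bounds[OF h G[OF that]] by simp
  have "tensor_rels A B \<subseteq> hom_ker (free_on_pairs A B) h \<longleftrightarrow> (\<forall>(s, t) \<in> tensor_rels A B. h s = h t)"
    using tensor_rels_closed[OF A B] by (auto simp: hom_ker_def)
  also have "\<dots> \<longleftrightarrow> bimorphism A B (\<lambda>(a, b). h (pair_gen A B a b))"
  proof
    assume *: "\<forall>(s, t) \<in> tensor_rels A B. h s = h t"
    then have r: "h s = h t" if "(s, t) \<in> tensor_rels A B" for s t using that by blast
    note R = tensor_rels.intros[where A = A and B = B, THEN r]
    show "bimorphism A B (\<lambda>(a, b). h (pair_gen A B a b))"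
      unfolding bimorphism_def mv_additive_def prod.case
    proof (intro conjI ballI impI)
      fix a x y assume *: "a \<in> carrier A" "x \<in> carrier B" "y \<in> carrier B"
      { assume z: "x \<odot>\<^bsub>B\<^esub> y = \<zero>\<^bsub>B\<^esub>"
        \<comment> \<open>The \<odot>-relation says that max 0 (s - 1) = 0 for the sum s of the two
          values; the bound then removes the truncation min s 1 in the \<oplus>-relation.\<close>
        show le: "h (pair_gen A B a x) + h (pair_gen A B a y) \<le> 1"
          using R(8)[OF * z] * by (simp add: H G)
        show "h (pair_gen A B a (x \<oplus>\<^bsub>B\<^esub> y)) = h (pair_gen A B a x) + h (pair_gen A B a y)"
          using R(9)[OF * z] * le by (simp add: H G) }
    next
      fix b x y assume *: "b \<in> carrier B" "x \<in> carrier A" "y \<in> carrier A"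
      { assume z: "x \<odot>\<^bsub>A\<^esub> y = \<zero>\<^bsub>A\<^esub>"
        show le: "h (pair_gen A B x b) + h (pair_gen A B y b) \<le> 1"
          using R(10)[OF *(2,3,1) z] * by (simp add: H G)
        show "h (pair_gen A B (x \<oplus>\<^bsub>A\<^esub> y) b) = h (pair_gen A B x b) + h (pair_gen A B y b)"
          using R(11)[OF *(2,3,1) z] * le by (simp add: H G) }
    qed (simp_all add: R(1-7) H G)
  next
    assume "bimorphism A B (\<lambda>(a, b). h (pair_gen A B a b))"
    note b = this[unfolded bimorphism_def mv_additive_def prod.case]
    have "h s = h t" if "(s, t) \<in> tensor_rels A B" for s t
      using that by cases (use b in \<open>auto simp: H G\<close>)
    then show "\<forall>(s, t) \<in> tensor_rels A B. h s = h t" by blast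
  qed
  finally show ?thesis .
qed

section \<open>The spectrum of the semisimple tensor product\<close>

text \<open>The composite of the two quotient maps from the free algebra, first modulo the tensor
  relations and then modulo the radical.\<close>

definition tensor_class :: "'a mv \<Rightarrow> 'b mv \<Rightarrow> ('a \<times> 'b) mv_term set \<Rightarrow> ('a \<times> 'b) mv_term set set set"
  where "tensor_class A B t =
    radical (mv_tensor A B) `` {cong_gen (free_on_pairs A B) (tensor_rels A B) `` {t}}"

context
  fixes A :: "'a mv" and B :: "'b mv"
  assumes A: "mv_algebra A" and B: "mv_algebra B"
begin

lemma congruence_tensor: "congruence (free_on_pairs A B) (cong_gen (free_on_pairs A B) (tensor_rels A B))"
  by (rule congruence_cong_gen)
    (use mv_algebraD[OF mv_algebra_free] tensor_rels_closed[OF A B] in auto)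

lemma mv_algebra_tensor: "mv_algebra (mv_tensor A B)"
  unfolding mv_tensor_def by (rule mv_algebra_quot[OF mv_algebra_free congruence_tensor])

lemma carrier_ss_tensor: "carrier (ss_tensor A B) = tensor_class A B ` carrier (free_on_pairs A B)"
  by (simp add: ss_tensor_def quot_mv_ops(1)[OF congruence_radical[OF mv_algebra_tensor]]
      quot_mv_ops(1)[OF congruence_tensor, folded mv_tensor_def] image_image tensor_class_def)

text \<open>Pulling back along both quotient maps gives a homomorphism, and related elements already
  have equal classes after the first quotient.\<close>

lemma mv_W_tensor_class:
  assumes \<phi>: "\<phi> \<in> mv_W (ss_tensor A B)"
  defines "h \<equiv> \<lambda>t\<in>carrier (free_on_pairs A B). \<phi> (tensor_class A B t)"
  shows "h \<in> mv_W (free_on_pairs A B)" and "tensor_rels A B \<subseteq> hom_ker (free_on_pairs A B) h"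
proof -
  let ?F = "free_on_pairs A B" let ?\<theta> = "cong_gen ?F (tensor_rels A B)"
  note q = quot_mv_ops(1)[OF congruence_tensor, folded mv_tensor_def]
  have "(\<lambda>X\<in>carrier (mv_tensor A B). \<phi> (radical (mv_tensor A B) `` {X})) \<in> mv_hom (mv_tensor A B) std_mv"
    using mv_hom_quot_comp[OF mv_algebra_tensor congruence_radical[OF mv_algebra_tensor]] \<phi>
    by (simp add: mv_W_def ss_tensor_def)
  then have "(\<lambda>t\<in>carrier ?F. (\<lambda>X\<in>carrier (mv_tensor A B). \<phi> (radical (mv_tensor A B) `` {X})) (?\<theta> `` {t}))
      \<in> mv_hom ?F std_mv"
    using mv_hom_quot_comp[OF mv_algebra_free congruence_tensor, folded mv_tensor_def] by blast
  also have "(\<lambda>t\<in>carrier ?F. (\<lambda>X\<in>carrier (mv_tensor A B). \<phi> (radical (mv_tensor A B) `` {X})) (?\<theta> `` {t})) = h"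
    by (auto simp: h_def q tensor_class_def)
  finally show "h \<in> mv_W ?F" by (simp add: mv_W_def)
  have "?\<theta> `` {s} = ?\<theta> `` {t}" if "(s, t) \<in> tensor_rels A B" for s t
    using that cong_gen_incl equiv_class_eq[OF congruenceD(1)[OF congruence_tensor]] by blast
  then show "tensor_rels A B \<subseteq> hom_ker ?F h"
    using tensor_rels_closed[OF A B] by (fastforce simp: hom_ker_def h_def tensor_class_def)
qed

text \<open>The map descends twice: its kernel is a congruence containing the relations, hence the
  congruence they generate, and the kernel of the induced map is maximal, hence contains the
  radical.\<close>

lemma mv_W_tensor_lift:
  assumes h: "h \<in> mv_W (free_on_pairs A B)" and ker: "tensor_rels A B \<subseteq> hom_ker (free_on_pairs A B) h"
  obtains \<phi> where "\<phi> \<in> mv_W (ss_tensor A B)"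
    "\<And>t. t \<in> carrier (free_on_pairs A B) \<Longrightarrow> \<phi> (tensor_class A B t) = h t"
proof -
  let ?F = "free_on_pairs A B" let ?\<theta> = "cong_gen ?F (tensor_rels A B)" let ?T = "mv_tensor A B"
  note q = quot_mv_ops(1)[OF congruence_tensor, folded mv_tensor_def]
  have h': "h \<in> mv_hom ?F std_mv" using h by (simp add: mv_W_def)
  have "?\<theta> \<subseteq> hom_ker ?F h"
    by (rule cong_gen_least[OF congruence_hom_ker[OF mv_algebra_free h'] ker])
  then obtain k where k: "k \<in> mv_hom ?T std_mv" "\<And>t. t \<in> carrier ?F \<Longrightarrow> k (?\<theta> `` {t}) = h t"
    using mv_hom_quot_lift[OF mv_algebra_free congruence_tensor h', folded mv_tensor_def] by blast
  have "maximal_congruence ?T (hom_ker ?T k)"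
    using maximal_congruence_hom_ker[OF mv_algebra_tensor] k(1) by (simp add: mv_W_def)
  then have "radical ?T \<subseteq> hom_ker ?T k" by (auto simp: radical_def)
  then obtain \<phi> where \<phi>: "\<phi> \<in> mv_hom (ss_tensor A B) std_mv"
      "\<And>X. X \<in> carrier ?T \<Longrightarrow> \<phi> (radical ?T `` {X}) = k X"
    using mv_hom_quot_lift[OF mv_algebra_tensor congruence_radical[OF mv_algebra_tensor] k(1),
        folded ss_tensor_def] by blast
  have "\<phi> (tensor_class A B t) = h t" if "t \<in> carrier ?F" for t
    using that by (simp add: tensor_class_def \<phi>(2) q k(2))
  then show ?thesis using \<phi>(1) that by (simp add: mv_W_def)
qed

end

section \<open>Restriction to the generators as a \<int>-homeomorphism\<close>

theorem theorem4p4: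
  fixes A :: "'a mv" and B :: "'b mv"
  assumes "mv_algebra A" and "semisimple_mv A"
    and "mv_algebra B" and "semisimple_mv B"
  shows "Z_homeomorphic
           (carrier (ss_tensor A B)) (mv_W (ss_tensor A B))
           (carrier A \<times> carrier B) (cube_mult A B ` (mv_W A \<times> mv_W B))"
proof -
  note A = assms(1) and B = assms(3)
  let ?F = "free_on_pairs A B" and ?I = "carrier (ss_tensor A B)" and ?J = "carrier A \<times> carrier B"
  let ?P = "mv_W (ss_tensor A B)" and ?Q = "cube_mult A B ` (mv_W A \<times> mv_W B)"
  let ?c = "tensor_class A B"
  define \<eta> where "\<eta> \<phi> = (\<lambda>j\<in>?J. \<phi> (?c (gen ?J j)))" for \<phi> :: "_ \<Rightarrow> real"
  have cl: "?c t \<in> ?I" if "t \<in> carrier ?F" for t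
    using that by (simp add: carrier_ss_tensor[OF A B])
  have P: "?P \<subseteq> cube ?I" by (auto simp: mv_W_def mv_hom_def cube_def std_mv_def)
  have Q: "?Q \<subseteq> cube ?J"
  proof clarify
    fix f g assume "f \<in> mv_W A" "g \<in> mv_W B"
    then show "cube_mult A B (f, g) \<in> cube ?J"
      unfolding cube_def cube_mult_def prod.case
      by (intro PiE_I) (auto simp: mv_W_bounds mult_le_one)
  qed
  \<comment> \<open>By uniqueness of extensions, evaluating at the restriction of \<phi> is the same
    as passing to the tensor product and applying \<phi>. This yields injectivity and also the terms
    for the inverse.\<close>
  have bar_\<eta>: "bar ?J (\<eta> \<phi>) t = \<phi> (?c t)" if \<phi>: "\<phi> \<in> ?P" and t: "t \<in> carrier ?F" for \<phi> t
  proof -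
    have "bar ?J (\<eta> \<phi>) = (\<lambda>t\<in>carrier ?F. \<phi> (?c t))"
    proof (rule bar_eqI[OF mv_W_tensor_class(1)[OF A B \<phi>]])
      show "\<eta> \<phi> j \<in> {0..1}" if j: "j \<in> ?J" for j
        using mv_W_bounds[OF \<phi> cl[OF gen_closed[OF j]]] j by (simp add: \<eta>_def)
    qed (simp add: \<eta>_def gen_closed)
    then show ?thesis using t by simp
  qed
  have inj: "inj_on \<eta> ?P"
  proof (rule inj_onI)
    fix \<phi> \<psi> assume *: "\<phi> \<in> ?P" "\<psi> \<in> ?P" "\<eta> \<phi> = \<eta> \<psi>"
    have "\<phi> (?c t) = \<psi> (?c t)" if "t \<in> carrier ?F" for t
      using bar_\<eta>[OF *(1) that] bar_\<eta>[OF *(2) that] *(3) by simp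
    then have "\<phi> x = \<psi> x" if "x \<in> ?I" for x
      using that by (auto simp: carrier_ss_tensor[OF A B])
    then show "\<phi> = \<psi>" using * mv_hom_eqI unfolding mv_W_def by blast
  qed
  have "\<eta> \<phi> \<in> ?Q" if \<phi>: "\<phi> \<in> ?P" for \<phi>
  proof -
    let ?h = "\<lambda>t\<in>carrier ?F. \<phi> (?c t)"
    note h = mv_W_tensor_class[OF A B \<phi>]
    have bi: "bimorphism A B (\<lambda>(a, b). ?h (pair_gen A B a b))"
      using tensor_rels_subset_hom_ker_iff[OF A B h(1)] h(2) by blast
    have "0 \<le> (\<lambda>(a, b). ?h (pair_gen A B a b)) (a, b)"
      if "a \<in> carrier A" "b \<in> carrier B" for a b
      using mv_W_bounds(1)[OF h(1) gen_closed, of "(a, b)"] that by simp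
    from bimorphism_factor[OF A B bi this] obtain f g where fg: "f \<in> mv_W A" "g \<in> mv_W B"
      "\<And>a b. a \<in> carrier A \<Longrightarrow> b \<in> carrier B \<Longrightarrow> ?h (pair_gen A B a b) = f a * g b"
      unfolding prod.case by blast
    have "\<eta> \<phi> = cube_mult A B (f, g)"
      using fg(3) by (auto simp: \<eta>_def cube_mult_def gen_closed)
    then show ?thesis using fg by blast
  qed
  moreover have "q \<in> \<eta> ` ?P" if "q \<in> ?Q" for q
  proof -
    obtain f g where fg: "f \<in> mv_W A" "g \<in> mv_W B" and q: "q = cube_mult A B (f, g)"
      using \<open>q \<in> ?Q\<close> by blast
    \<comment> \<open>A preimage of q is found by extending q to the free algebra: the extension
      respects the relations because its values on generators are products, so it descends.\<close>
    have "q j \<in> {0..1}" if "j \<in> ?J" for j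
      using Q \<open>q \<in> ?Q\<close> that unfolding cube_def by blast
    note h = bar_hom[of ?J q, OF this]
    have "bimorphism A B (\<lambda>(a, b). bar ?J q (pair_gen A B a b))"
    proof (rule bimorphism_mult[OF A B fg])
      fix a b assume "a \<in> carrier A" "b \<in> carrier B"
      then show "(\<lambda>(a, b). bar ?J q (pair_gen A B a b)) (a, b) = f a * g b"
        using h(2)[of "(a, b)"] by (simp add: q cube_mult_def)
    qed
    then have "tensor_rels A B \<subseteq> hom_ker ?F (bar ?J q)"
      using tensor_rels_subset_hom_ker_iff[OF A B h(1)] by simp
    then obtain \<phi> where \<phi>: "\<phi> \<in> ?P" "\<And>t. t \<in> carrier ?F \<Longrightarrow> \<phi> (?c t) = bar ?J q t"
      using mv_W_tensor_lift[OF A B h(1)] by blast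
    have "q \<in> extensional ?J" using Q \<open>q \<in> ?Q\<close> unfolding cube_def PiE_def by blast
    moreover have "\<eta> \<phi> j = q j" if "j \<in> ?J" for j
      using that by (simp only: \<eta>_def restrict_apply' \<phi>(2)[OF gen_closed[OF that]] h(2))
    ultimately have "\<eta> \<phi> = q" by (intro extensionalityI[of _ ?J]) (auto simp: \<eta>_def)
    then show ?thesis using \<phi>(1) by blast
  qed
  ultimately have bij: "bij_betw \<eta> ?P ?Q"
    using inj unfolding bij_betw_def by blast
  have "definable ?I ?P ?J ?Q \<eta>"
    unfolding definable_def
  proof (intro conjI exI ballI)
    show "\<eta> \<in> ?P \<rightarrow> ?Q" using bij bij_betwE by blast
    fix j assume j: "j \<in> ?J"
    \<comment> \<open>Each coordinate of the image is a coordinate of \<phi>, so the term for j is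
      the variable indexed by the class of the generator j.\<close>
    show "gen ?I (?c (gen ?J j)) \<in> carrier (free_mv ?I)"
      using j by (intro gen_closed cl)
    fix \<phi> assume \<phi>: "\<phi> \<in> ?P"
    show "\<eta> \<phi> j = bar ?I \<phi> (gen ?I (?c (gen ?J j)))"
      using j bar_hom(2)[of ?I \<phi>] mv_W_bounds[OF \<phi>] cl[OF gen_closed[OF j]] by (simp add: \<eta>_def)
  qed
  moreover have "definable ?J ?Q ?I ?P (inv_into ?P \<eta>)"
    unfolding definable_def
  proof (intro conjI exI ballI)
    show "inv_into ?P \<eta> \<in> ?Q \<rightarrow> ?P" using bij_betwE[OF bij_betw_inv_into[OF bij]] by blast
    fix x assume x: "x \<in> ?I"
    \<comment> \<open>The term for x is any representative of x in the free algebra on pairs, chosen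
      independently of q.\<close>
    then have r: "inv_into (carrier ?F) ?c x \<in> carrier ?F" "?c (inv_into (carrier ?F) ?c x) = x"
      by (simp_all add: carrier_ss_tensor[OF A B] inv_into_into f_inv_into_f)
    show "inv_into (carrier ?F) ?c x \<in> carrier ?F" by (rule r(1))
    fix q assume q: "q \<in> ?Q"
    then have "inv_into ?P \<eta> q \<in> ?P" "\<eta> (inv_into ?P \<eta> q) = q"
      using bij by (auto simp: bij_betw_def inv_into_into f_inv_into_f)
    then show "inv_into ?P \<eta> q x = bar ?J q (inv_into (carrier ?F) ?c x)"
      using bar_\<eta>[OF _ r(1)] r(2) by metis
  qed
  ultimately show ?thesis
    unfolding Z_homeomorphic_def using P Q bij by blast
qed

end
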